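(* Let $A=(A,\nabla_A,\eta_A,\Delta_A,\epsilon_A)$ and $B=(B,\nabla_B,\eta_B,\Delta_B,\epsilon_B)$ be $k$-bialgebras, and let $\tau:B\otimes A\rightarrow A\otimes B$ be a twisting map. Then $A\otimes_{\tau} B$ inherits a $k$-bialgebra structure, i.e. $(A\otimes_{\tau} B,\nabla_{A\otimes_{\tau} B},\eta_{A\otimes_{\tau} B},\Delta_{A\otimes_{\tau} B},\epsilon_{A\otimes_{\tau} B})$ is a $k$-bialgebra, if and only if $\tau$ is trivial.
   Context: $k$ is a field of arbitrary characteristic, $\otimes=\otimes_k$, and $1$ denotes identity maps. Algebras are associative and unital, coalgebras are coassociative and counital. A twisting map for algebras $(A,\nabla_A,\eta_A)$, $(B,\nabla_B,\eta_B)$ is a bijective $k$-linear map $\tau:B\otimes A\to A\otimes B$ such that $\tau(b\otimes 1_A)=1_A\otimes b$ and $\tau(1_B\otimes a)=a\otimes 1_B$ for all $a\in A$, $b\in B$, and $\tau(\nabla_B\otimes\nabla_A)=(\nabla_A\otimes\nabla_B)(1\otimes\tau\otimes 1)(\tau\otimes\tau)(1\otimes\tau\otimes 1)$ as maps $B\otimes B\otimes A\otimes A\to A\otimes B$. The trivial twisting map is the flip $b\otimes a\mapsto a\otimes b$. The twisted tensor product $A\otimes_\tau B$ is the vector space $A\otimes B$ with $\nabla_{A\otimes_\tau B}=(\nabla_A\otimes\nabla_B)(1\otimes\tau\otimes 1)$ and unit $\eta_{A\otimes_\tau B}=\eta_A\otimes\eta_B$ (using $k\cong k\otimes k$). When $A$,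 $B$ are coalgebras, put $\Delta_{A\otimes_\tau B}=(1\otimes\tau^{-1}\otimes 1)(\Delta_A\otimes\Delta_B)$ and $\epsilon_{A\otimes_\tau B}=\epsilon_A\otimes\epsilon_B$ (using $k\otimes k\cong k$). A bialgebra has its usual meaning (with the flip used in the compatibility of multiplication and comultiplication). *)

theory Defs
  imports "HOL-Algebra.AbelCoset" "Jordan_Normal_Form.Missing_VectorSpace"
begin

text \<open>
  Vector spaces over a field \<open>K\<close> are the carrier-based records of the locale \<^locale>\<open>vectorspace\<close>.
  The fields \<open>mult\<close> and \<open>one\<close> of a \<open>module\<close> record carry no information here: the multiplication
  and the unit of an algebra are separate linear maps \<open>A \<otimes> A \<rightarrow> A\<close> and \<open>K \<rightarrow> A\<close>.
\<close>

section \<open>Tensor products\<close>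

definition free_space :: "('k, 'r) ring_scheme \<Rightarrow> 's set \<Rightarrow> ('k, 's \<Rightarrow> 'k) module" where
  "free_space K S =
     \<lparr>carrier = {f. f \<in> S \<rightarrow> carrier K \<and> (\<forall>s. s \<notin> S \<longrightarrow> f s = \<zero>\<^bsub>K\<^esub>) \<and> finite {s. f s \<noteq> \<zero>\<^bsub>K\<^esub>}},
      mult = (\<lambda>_ _ _. \<zero>\<^bsub>K\<^esub>), one = (\<lambda>_. \<zero>\<^bsub>K\<^esub>), zero = (\<lambda>_. \<zero>\<^bsub>K\<^esub>),
      add = (\<lambda>f g s. f s \<oplus>\<^bsub>K\<^esub> g s), smult = (\<lambda>c f s. c \<otimes>\<^bsub>K\<^esub> f s)\<rparr>"

definition free_gen :: "('k, 'r) ring_scheme \<Rightarrow> 's \<Rightarrow> 's \<Rightarrow> 'k" where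
  "free_gen K s = (\<lambda>t. if t = s then \<one>\<^bsub>K\<^esub> else \<zero>\<^bsub>K\<^esub>)"

text \<open>Scalars act on cosets through representatives; the naive image \<open>{c \<odot> x | x \<in> X}\<close> would not be
  a coset for \<open>c = 0\<close>, hence the union.\<close>

definition quot_space :: "('k, 'v, 'm) module_scheme \<Rightarrow> 'v set \<Rightarrow> ('k, 'v set) module" where
  "quot_space V N =
     \<lparr>carrier = a_rcosets\<^bsub>V\<^esub> N,
      mult = (\<lambda>_ _. N), one = N, zero = N,
      add = (\<lambda>X Y. X <+>\<^bsub>V\<^esub> Y), smult = (\<lambda>c X. \<Union>x\<in>X. N +>\<^bsub>V\<^esub> (c \<odot>\<^bsub>V\<^esub> x))\<rparr>"

definition tens_rels ::
  "('k, 'r) ring_scheme \<Rightarrow> ('k, 'v, 'm) module_scheme \<Rightarrow> ('k, 'w, 'n) module_scheme \<Rightarrow> ('v \<times> 'w \<Rightarrow> 'k) set"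
where
  "tens_rels K V W =
     (let F = free_space K (carrier V \<times> carrier W); d = (\<lambda>v w. free_gen K (v, w)) in
      {d (v \<oplus>\<^bsub>V\<^esub> v') w \<ominus>\<^bsub>F\<^esub> (d v w \<oplus>\<^bsub>F\<^esub> d v' w) | v v' w.
         v \<in> carrier V \<and> v' \<in> carrier V \<and> w \<in> carrier W} \<union>
      {d v (w \<oplus>\<^bsub>W\<^esub> w') \<ominus>\<^bsub>F\<^esub> (d v w \<oplus>\<^bsub>F\<^esub> d v w') | v w w'.
         v \<in> carrier V \<and> w \<in> carrier W \<and> w' \<in> carrier W} \<union>
      {d (c \<odot>\<^bsub>V\<^esub> v) w \<ominus>\<^bsub>F\<^esub> (c \<odot>\<^bsub>F\<^esub> d v w) | c v w.
         c \<in> carrier K \<and> v \<in> carrier V \<and> w \<in> carrier W} \<union>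
      {d v (c \<odot>\<^bsub>W\<^esub> w) \<ominus>\<^bsub>F\<^esub> (c \<odot>\<^bsub>F\<^esub> d v w) | c v w.
         c \<in> carrier K \<and> v \<in> carrier V \<and> w \<in> carrier W})"

definition tens_null ::
  "('k, 'r) ring_scheme \<Rightarrow> ('k, 'v, 'm) module_scheme \<Rightarrow> ('k, 'w, 'n) module_scheme \<Rightarrow> ('v \<times> 'w \<Rightarrow> 'k) set"
where
  "tens_null K V W = module.span K (free_space K (carrier V \<times> carrier W)) (tens_rels K V W)"

definition tens ::
  "('k, 'r) ring_scheme \<Rightarrow> ('k, 'v, 'm) module_scheme \<Rightarrow> ('k, 'w, 'n) module_scheme
    \<Rightarrow> ('k, ('v \<times> 'w \<Rightarrow> 'k) set) module"
where
  "tens K V W = quot_space (free_space K (carrier V \<times> carrier W)) (tens_null K V W)"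

definition ptens ::
  "('k, 'r) ring_scheme \<Rightarrow> ('k, 'v, 'm) module_scheme \<Rightarrow> ('k, 'w, 'n) module_scheme
    \<Rightarrow> 'v \<Rightarrow> 'w \<Rightarrow> ('v \<times> 'w \<Rightarrow> 'k) set"
where
  "ptens K V W v w =
     tens_null K V W +>\<^bsub>free_space K (carrier V \<times> carrier W)\<^esub> free_gen K (v, w)"

text \<open>The linear map \<open>V \<otimes> W \<rightarrow> U\<close> induced by a bilinear map \<open>\<phi> : V \<times> W \<rightarrow> U\<close>; it exists and is
  unique by lemmas \<open>tlift\<close> and \<open>tens_ext\<close> below.\<close>

definition tlift ::
  "('k, 'r) ring_scheme \<Rightarrow> ('k, 'v, 'm) module_scheme \<Rightarrow> ('k, 'w, 'n) module_scheme
    \<Rightarrow> ('k, 'u, 'p) module_scheme \<Rightarrow> ('v \<Rightarrow> 'w \<Rightarrow> 'u) \<Rightarrow> ('v \<times> 'w \<Rightarrow> 'k) set \<Rightarrow> 'u"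
where
  "tlift K V W U \<phi> = (THE h. h \<in> extensional (carrier (tens K V W)) \<and>
     linear_map K (tens K V W) U h \<and>
     (\<forall>v\<in>carrier V. \<forall>w\<in>carrier W. h (ptens K V W v w) = \<phi> v w))"

text \<open>\<open>f \<otimes> g : V \<otimes> W \<rightarrow> V' \<otimes> W'\<close> for \<open>f : V \<rightarrow> V'\<close>, \<open>g : W \<rightarrow> W'\<close>\<close>

definition tmap where
  "tmap K V W V' W' f g = tlift K V W (tens K V' W') (\<lambda>v w. ptens K V' W' (f v) (g w))"

definition tflip where
  "tflip K V W = tlift K V W (tens K W V) (\<lambda>v w. ptens K W V w v)"

text \<open>The associators \<open>(U \<otimes> V) \<otimes> W \<rightarrow> U \<otimes> (V \<otimes> W)\<close> and back\<close>

definition assoc_r where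
  "assoc_r K U V W =
     tlift K (tens K U V) W (tens K U (tens K V W))
       (\<lambda>x w. tlift K U V (tens K U (tens K V W))
                 (\<lambda>u v. ptens K U (tens K V W) u (ptens K V W v w)) x)"

definition assoc_l where
  "assoc_l K U V W =
     tlift K U (tens K V W) (tens K (tens K U V) W)
       (\<lambda>u y. tlift K V W (tens K (tens K U V) W)
                 (\<lambda>v w. ptens K (tens K U V) W (ptens K U V u v) w) y)"

text \<open>\<open>1 \<otimes> f \<otimes> 1 : (U \<otimes> V) \<otimes> (W \<otimes> X) \<rightarrow> (U \<otimes> V') \<otimes> (W' \<otimes> X)\<close> for \<open>f : V \<otimes> W \<rightarrow> V' \<otimes> W'\<close>\<close>

definition mid_map where
  "mid_map K U V W X V' W' f =
     assoc_l K U V' (tens K W' X)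
     \<circ> tmap K U (tens K (tens K V' W') X) U (tens K V' (tens K W' X)) id (assoc_r K V' W' X)
     \<circ> tmap K U (tens K (tens K V W) X) U (tens K (tens K V' W') X) id
         (tmap K (tens K V W) X (tens K V' W') X f id)
     \<circ> tmap K U (tens K V (tens K W X)) U (tens K (tens K V W) X) id (assoc_l K V W X)
     \<circ> assoc_r K U V (tens K W X)"

text \<open>The ground field as a vector space, and the isomorphisms \<open>k \<otimes> V \<cong> V\<close>, \<open>V \<otimes> k \<cong> V\<close>,
  \<open>k \<cong> k \<otimes> k\<close>\<close>

definition ground :: "('k, 'r) ring_scheme \<Rightarrow> ('k, 'k) module" where
  "ground K = \<lparr>carrier = carrier K, mult = mult K, one = one K, zero = zero K, add = add K,
      smult = mult K\<rparr>"

definition lunit where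
  "lunit K V = tlift K (ground K) V V (\<lambda>c v. c \<odot>\<^bsub>V\<^esub> v)"

definition runit where
  "runit K V = tlift K V (ground K) V (\<lambda>v c. c \<odot>\<^bsub>V\<^esub> v)"

definition ground_split where
  "ground_split K c = ptens K (ground K) (ground K) c \<one>\<^bsub>K\<^esub>"


section \<open>Algebras, coalgebras, bialgebras\<close>

locale k_algebra = vectorspace K A
  for K :: "('k, 'r) ring_scheme" and A :: "('k, 'a, 'm) module_scheme" +
  fixes nabla :: "('a \<times> 'a \<Rightarrow> 'k) set \<Rightarrow> 'a"
    and eta :: "'k \<Rightarrow> 'a"
  assumes nabla_linear: "linear_map K (tens K A A) A nabla"
    and eta_linear: "linear_map K (ground K) A eta"
    and nabla_assoc: "x \<in> carrier (tens K (tens K A A) A) \<Longrightarrow>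
          nabla (tmap K (tens K A A) A A A nabla id x)
          = nabla (tmap K A (tens K A A) A A id nabla (assoc_r K A A A x))"
    and eta_left: "y \<in> carrier (tens K (ground K) A) \<Longrightarrow>
          nabla (tmap K (ground K) A A A eta id y) = lunit K A y"
    and eta_right: "z \<in> carrier (tens K A (ground K)) \<Longrightarrow>
          nabla (tmap K A (ground K) A A id eta z) = runit K A z"

locale k_coalgebra = vectorspace K A
  for K :: "('k, 'r) ring_scheme" and A :: "('k, 'a, 'm) module_scheme" +
  fixes delta :: "'a \<Rightarrow> ('a \<times> 'a \<Rightarrow> 'k) set"
    and eps :: "'a \<Rightarrow> 'k"
  assumes delta_linear: "linear_map K A (tens K A A) delta"
    and eps_linear: "linear_map K A (ground K) eps"
    and delta_coassoc: "a \<in> carrier A \<Longrightarrow>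
          assoc_r K A A A (tmap K A A (tens K A A) A delta id (delta a))
          = tmap K A A A (tens K A A) id delta (delta a)"
    and eps_left: "a \<in> carrier A \<Longrightarrow> lunit K A (tmap K A A (ground K) A eps id (delta a)) = a"
    and eps_right: "a \<in> carrier A \<Longrightarrow> runit K A (tmap K A A A (ground K) id eps (delta a)) = a"

locale k_bialgebra = k_algebra K A nabla eta + k_coalgebra K A delta eps
  for K :: "('k, 'r) ring_scheme" and A :: "('k, 'a, 'm) module_scheme"
    and nabla eta delta eps +
  assumes delta_nabla: "x \<in> carrier (tens K A A) \<Longrightarrow>
          delta (nabla x)
          = tmap K (tens K A A) (tens K A A) A A nabla nabla
              (mid_map K A A A A A A (tflip K A A)
                (tmap K A A (tens K A A) (tens K A A) delta delta x))"
    and delta_eta: "c \<in> carrier K \<Longrightarrow>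
          delta (eta c) = tmap K (ground K) (ground K) A A eta eta (ground_split K c)"
    and eps_nabla: "x \<in> carrier (tens K A A) \<Longrightarrow>
          eps (nabla x) = lunit K (ground K) (tmap K A A (ground K) (ground K) eps eps x)"
    and eps_eta: "c \<in> carrier K \<Longrightarrow> eps (eta c) = c"


section \<open>Twisting maps and twisted tensor products\<close>

locale twisting_map =
  A: k_algebra K A nablaA etaA + B: k_algebra K B nablaB etaB
  for K :: "('k, 'r) ring_scheme"
    and A :: "('k, 'a, 'm) module_scheme" and nablaA etaA
    and B :: "('k, 'b, 'n) module_scheme" and nablaB etaB +
  fixes tau :: "('b \<times> 'a \<Rightarrow> 'k) set \<Rightarrow> ('a \<times> 'b \<Rightarrow> 'k) set"
  assumes tau_linear: "linear_map K (tens K B A) (tens K A B) tau"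
    and tau_bij: "bij_betw tau (carrier (tens K B A)) (carrier (tens K A B))"
    and tau_unit_A: "b \<in> carrier B \<Longrightarrow>
          tau (ptens K B A b (etaA \<one>\<^bsub>K\<^esub>)) = ptens K A B (etaA \<one>\<^bsub>K\<^esub>) b"
    and tau_unit_B: "a \<in> carrier A \<Longrightarrow>
          tau (ptens K B A (etaB \<one>\<^bsub>K\<^esub>) a) = ptens K A B a (etaB \<one>\<^bsub>K\<^esub>)"
    and tau_mult: "x \<in> carrier (tens K (tens K B B) (tens K A A)) \<Longrightarrow>
          tau (tmap K (tens K B B) (tens K A A) B A nablaB nablaA x)
          = tmap K (tens K A A) (tens K B B) A B nablaA nablaB
              (mid_map K A B A B A B tau
                (tmap K (tens K B A) (tens K B A) (tens K A B) (tens K A B) tau tau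
                  (mid_map K B B A A A B tau x)))"

definition trivial_twist where
  "trivial_twist K A B tau \<longleftrightarrow> (\<forall>x\<in>carrier (tens K B A). tau x = tflip K B A x)"

definition twist_nabla where
  "twist_nabla K A B nablaA nablaB tau =
     tmap K (tens K A A) (tens K B B) A B nablaA nablaB \<circ> mid_map K A B A B A B tau"

definition twist_eta where
  "twist_eta K A B etaA etaB = tmap K (ground K) (ground K) A B etaA etaB \<circ> ground_split K"

definition twist_delta where
  "twist_delta K A B deltaA deltaB tau =
     mid_map K A A B B B A (inv_into (carrier (tens K B A)) tau)
     \<circ> tmap K A B (tens K A A) (tens K B B) deltaA deltaB"

definition twist_eps where
  "twist_eps K A B epsA epsB =
     lunit K (ground K) \<circ> tmap K A B (ground K) (ground K) epsA epsB"


section \<open>Well-definedness of the constructions\<close>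

text \<open>The universal property of \<open>tens\<close> (\<open>tlift\<close>, \<open>tens_ext\<close>), and the values on pure tensors of the maps
  defined through it.\<close>

lemma free_space_vs:
  fixes K (structure)
  assumes "field K" shows "vectorspace K (free_space K S)"
proof -
  interpret field K by fact
  have "module K (free_space K S)"
  proof (rule module_criteria, goal_cases)
    case 3
    have "finite {s. f s \<oplus> g s \<noteq> \<zero>}" if "finite {s. f s \<noteq> \<zero>}" "finite {s. g s \<noteq> \<zero>}" for f g
      by (rule finite_subset[OF _ finite_UnI[OF that]]) auto
    then show ?case by (auto simp: free_space_def Pi_iff)
  next
    case 4
    show ?case
    proof
      fix f assume f: "f \<in> carrier (free_space K S)"
      have fc: "f s \<in> carrier K" for s using f by (cases "s \<in> S") (auto simp: free_space_def)
      have e: "{s. \<ominus> f s \<noteq> \<zero>} \<subseteq> {s. f s \<noteq> \<zero>}" by auto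
      have "(\<lambda>s. \<ominus> f s) \<in> carrier (free_space K S)"
        using f finite_subset[OF e] by (auto simp: free_space_def Pi_iff)
      moreover have "f \<oplus>\<^bsub>free_space K S\<^esub> (\<lambda>s. \<ominus> f s) = \<zero>\<^bsub>free_space K S\<^esub>"
        using fc by (auto simp: free_space_def r_neg)
      ultimately show "\<exists>g\<in>carrier (free_space K S). f \<oplus>\<^bsub>free_space K S\<^esub> g = \<zero>\<^bsub>free_space K S\<^esub>"
        by blast
    qed
  next
    case 5
    have "finite {s. c \<otimes> f s \<noteq> \<zero>}" if "finite {s. f s \<noteq> \<zero>}" "c \<in> carrier K" for c f
      by (rule finite_subset[OF _ that(1)]) (use that in auto)
    then show ?case by (auto simp: free_space_def Pi_iff)
  next
    case 1 show ?case by (rule is_cring)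
  next
    case 2 show ?case by (auto simp: free_space_def)
  next
    case 6
    have "f s \<in> carrier K" if "f \<in> carrier (free_space K S)" for f s
      using that by (cases "s \<in> S") (auto simp: free_space_def)
    then show ?case by (auto simp: free_space_def a_comm)
  next
    case 7
    have "f s \<in> carrier K" if "f \<in> carrier (free_space K S)" for f s
      using that by (cases "s \<in> S") (auto simp: free_space_def)
    then show ?case by (simp add: free_space_def a_assoc)
  next
    case 8
    have "f s \<in> carrier K" if "f \<in> carrier (free_space K S)" for f s
      using that by (cases "s \<in> S") (auto simp: free_space_def)
    then show ?case by (simp add: free_space_def)
  next
    case 9
    have "f s \<in> carrier K" if "f \<in> carrier (free_space K S)" for f s
      using that by (cases "s \<in> S") (auto simp: free_space_def)
    then show ?case by (simp add: free_space_def m_assoc)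
  next
    case 10
    have "f s \<in> carrier K" if "f \<in> carrier (free_space K S)" for f s
      using that by (cases "s \<in> S") (auto simp: free_space_def)
    then show ?case by (simp add: free_space_def)
  next
    case 11
    have "f s \<in> carrier K" if "f \<in> carrier (free_space K S)" for f s
      using that by (cases "s \<in> S") (auto simp: free_space_def)
    then show ?case by (simp add: free_space_def l_distr)
  next
    case 12
    have "f s \<in> carrier K" if "f \<in> carrier (free_space K S)" for f s
      using that by (cases "s \<in> S") (auto simp: free_space_def)
    then show ?case by (simp add: free_space_def r_distr)
  qed
  then show ?thesis by (simp add: vectorspace_def field_axioms)
qed

locale quot =
  vectorspace K V for K and V (structure) and N +
  assumes N: "submodule K N V"
begin

lemma subgrp: "abelian_subgroup N V"
proof -
  interpret S: submodule K N V by (rule N)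
  have "additive_subgroup N V"
  proof (rule additive_subgroupI, unfold_locales, goal_cases)
    case 1 then show ?case using S.subset by simp
  next
    case (2 x y) then show ?case by simp
  next
    case 3 then show ?case by simp
  next
    case (4 x)
    then have x: "x \<in> carrier V" using S.subset by auto
    then have "inv\<^bsub>add_monoid V\<^esub> x = (\<ominus>\<^bsub>K\<^esub> \<one>\<^bsub>K\<^esub>) \<odot> x"
      using smult_l_minus[of "\<one>\<^bsub>K\<^esub>" x] by (simp add: a_inv_def[symmetric])
    then show ?case using 4 S.smult_closed[of "\<ominus>\<^bsub>K\<^esub> \<one>\<^bsub>K\<^esub>" x] by simp
  qed
  then show ?thesis
    by (intro abelian_subgroupI3) (auto intro: M.abelian_group_axioms)
qed

sublocale N: abelian_subgroup N V by (rule subgrp)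

abbreviation "Q \<equiv> quot_space V N"

lemma carrierQ: "carrier Q = (\<lambda>x. N +> x) ` carrier V"
  by (auto simp: quot_space_def A_RCOSETS_def')

lemma addQ: "x \<in> carrier V \<Longrightarrow> y \<in> carrier V \<Longrightarrow> (N +> x) \<oplus>\<^bsub>Q\<^esub> (N +> y) = N +> (x \<oplus> y)"
  by (simp add: quot_space_def N.a_rcos_sum)

lemma zeroQ: "\<zero>\<^bsub>Q\<^esub> = N +> \<zero>"
  by (simp add: quot_space_def N.a_subset)

lemma coset_eq: "x \<in> carrier V \<Longrightarrow> y \<in> carrier V \<Longrightarrow> N +> x = N +> y \<longleftrightarrow> x \<ominus> y \<in> N"
  by (metis N.a_rcos_module N.a_rcos_self N.a_repr_independence' a_minus_def M.abelian_group_axioms)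

lemma smultQ:
  assumes c: "c \<in> carrier K" and x: "x \<in> carrier V"
  shows "c \<odot>\<^bsub>Q\<^esub> (N +> x) = N +> (c \<odot> x)"
proof -
  have "N +> (c \<odot> y) = N +> (c \<odot> x)" if "y \<in> N +> x" for y
  proof -
    have y: "y \<in> carrier V" using that x N.a_elemrcos_carrier by blast
    then have "N +> y = N +> x" using that x N.a_repr_independence' by metis
    then have "y \<ominus> x \<in> N" using coset_eq x y by blast
    then have "c \<odot> (y \<ominus> x) \<in> N" using submodule.smult_closed[OF N] c by blast
    also have "c \<odot> (y \<ominus> x) = c \<odot> y \<ominus> c \<odot> x"
      using c x y by (simp add: a_minus_def smult_r_distr smult_r_minus)
    finally show ?thesis using coset_eq c x y by blast
  qed
  then have "(\<Union>y\<in>N +> x. N +> (c \<odot> y)) = N +> (c \<odot> x)"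
    using N.a_rcos_self[OF x] by blast
  then show ?thesis by (simp add: quot_space_def)
qed

lemma quot_vs: "vectorspace K Q"
proof -
  have "module K Q"
    apply (rule module_criteria)
    apply (rule R.is_cring)
    apply (auto simp: carrierQ zeroQ addQ smultQ M.a_ac smult_assoc1 smult_l_distr smult_r_distr)
    subgoal for x by (rule bexI[of _ "\<ominus> x"]) (simp_all add: addQ M.r_neg)
    done
  then show ?thesis by (simp add: vectorspace_def field_axioms)
qed

end


lemma linear_mapI:
  assumes "vectorspace K V" "vectorspace K W"
    and "\<And>x. x \<in> carrier V \<Longrightarrow> f x \<in> carrier W"
    and "\<And>x y. x \<in> carrier V \<Longrightarrow> y \<in> carrier V \<Longrightarrow> f (x \<oplus>\<^bsub>V\<^esub> y) = f x \<oplus>\<^bsub>W\<^esub> f y"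
    and "\<And>c x. c \<in> carrier K \<Longrightarrow> x \<in> carrier V \<Longrightarrow> f (c \<odot>\<^bsub>V\<^esub> x) = c \<odot>\<^bsub>W\<^esub> f x"
  shows "linear_map K V W f"
  using assms
  by (auto simp: linear_map_def mod_hom_def mod_hom_axioms_def module_hom_def vectorspace_def)

lemma free_gen_closed:
  assumes "field K" "s \<in> S" shows "free_gen K s \<in> carrier (free_space K S)"
proof -
  interpret field K by fact
  have "finite {t. free_gen K s t \<noteq> \<zero>\<^bsub>K\<^esub>}"
    by (rule finite_subset[of _ "{s}"]) (auto simp: free_gen_def)
  then show ?thesis using assms(2) by (auto simp: free_space_def free_gen_def)
qed

lemma free_space_induct:
  assumes K: "field K" and P: "submodule K P (free_space K S)"
    and gen: "\<And>s. s \<in> S \<Longrightarrow> free_gen K s \<in> P"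
    and f: "f \<in> carrier (free_space K S)"
  shows "f \<in> P"
proof -
  interpret field K by fact
  interpret P: submodule K P "free_space K S" by fact
  have "\<forall>f\<in>carrier (free_space K S). {s. f s \<noteq> \<zero>\<^bsub>K\<^esub>} \<subseteq> T \<longrightarrow> f \<in> P" if "finite T" for T
    using that
  proof (induction T)
    case empty
    have "f = \<zero>\<^bsub>free_space K S\<^esub>" if "{s. f s \<noteq> \<zero>\<^bsub>K\<^esub>} \<subseteq> {}" for f
      using that by (auto simp: free_space_def)
    then show ?case using P.zero_closed by metis
  next
    case (insert t T)
    show ?case
    proof (intro ballI impI)
      fix f assume f: "f \<in> carrier (free_space K S)" and sub: "{s. f s \<noteq> \<zero>\<^bsub>K\<^esub>} \<subseteq> insert t T"
      show "f \<in> P"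
      proof (cases "t \<in> S")
        case False
        then have "f t = \<zero>\<^bsub>K\<^esub>" using f by (auto simp: free_space_def)
        then have "{s. f s \<noteq> \<zero>\<^bsub>K\<^esub>} \<subseteq> T" using sub by auto
        then show ?thesis using insert f by blast
      next
        case True
        have fc: "f s \<in> carrier K" for s using f by (cases "s \<in> S") (auto simp: free_space_def)
        define g where "g = f(t := \<zero>\<^bsub>K\<^esub>)"
        have "finite {s. g s \<noteq> \<zero>\<^bsub>K\<^esub>}"
          by (rule finite_subset[of _ "{s. f s \<noteq> \<zero>\<^bsub>K\<^esub>}"])
            (use f in \<open>auto simp: free_space_def g_def\<close>)
        then have "g \<in> carrier (free_space K S)"
          using f by (auto simp: free_space_def g_def)
        moreover have "{s. g s \<noteq> \<zero>\<^bsub>K\<^esub>} \<subseteq> T" using sub by (auto simp: g_def)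
        ultimately have "g \<in> P" using insert by blast
        moreover have "f = g \<oplus>\<^bsub>free_space K S\<^esub> (f t \<odot>\<^bsub>free_space K S\<^esub> free_gen K t)"
          using fc by (auto simp: g_def free_space_def free_gen_def)
        ultimately show ?thesis
          using P.m_closed P.smult_closed gen[OF True] fc by metis
      qed
    qed
  qed
  then show ?thesis using f by (auto simp: free_space_def)
qed

definition free_lift :: "('k, 'r) ring_scheme \<Rightarrow> ('k, 'u, 'p) module_scheme \<Rightarrow> ('s \<Rightarrow> 'u) \<Rightarrow> ('s \<Rightarrow> 'k) \<Rightarrow> 'u" where
  "free_lift K U \<psi> f = (\<Oplus>\<^bsub>U\<^esub>s\<in>{s. f s \<noteq> \<zero>\<^bsub>K\<^esub>}. f s \<odot>\<^bsub>U\<^esub> \<psi> s)"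

lemma free_lift:
  assumes U: "vectorspace K U" and psi: "\<And>s. s \<in> S \<Longrightarrow> \<psi> s \<in> carrier U"
  shows "linear_map K (free_space K S) U (free_lift K U \<psi>)"
    and "\<And>s. s \<in> S \<Longrightarrow> free_lift K U \<psi> (free_gen K s) = \<psi> s"
proof -
  interpret U: vectorspace K U by fact
  let ?F = "free_space K S"
  have vF: "vectorspace K ?F" by (rule free_space_vs[OF U.field_axioms])
  interpret F: vectorspace K ?F by (rule vF)
  have fc: "f s \<in> carrier K" if "f \<in> carrier ?F" for f s
    using that by (cases "s \<in> S") (auto simp: free_space_def)
  have fin: "finite {s. f s \<noteq> \<zero>\<^bsub>K\<^esub>}" and sub: "{s. f s \<noteq> \<zero>\<^bsub>K\<^esub>} \<subseteq> S" if "f \<in> carrier ?F" for f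
    using that by (auto simp: free_space_def)
  have ext: "free_lift K U \<psi> f = (\<Oplus>\<^bsub>U\<^esub>s\<in>T. f s \<odot>\<^bsub>U\<^esub> \<psi> s)"
    if "f \<in> carrier ?F" "finite T" "T \<subseteq> S" "{s. f s \<noteq> \<zero>\<^bsub>K\<^esub>} \<subseteq> T" for f T
    unfolding free_lift_def
    by (rule U.M.add.finprod_mono_neutral_cong_left) (use that psi fc in auto)
  show "linear_map K ?F U (free_lift K U \<psi>)"
  proof (rule linear_mapI[OF vF U])
    fix f assume f: "f \<in> carrier ?F"
    show "free_lift K U \<psi> f \<in> carrier U"
      unfolding free_lift_def by (rule U.M.finsum_closed) (use psi fc[OF f] sub[OF f] in auto)
  next
    fix f g assume f: "f \<in> carrier ?F" and g: "g \<in> carrier ?F"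
    let ?T = "{s. f s \<noteq> \<zero>\<^bsub>K\<^esub>} \<union> {s. g s \<noteq> \<zero>\<^bsub>K\<^esub>}"
    have T: "finite ?T" "?T \<subseteq> S" using fin sub f g by blast+
    have fg: "f \<oplus>\<^bsub>?F\<^esub> g \<in> carrier ?F" using f g by simp
    have s: "(f \<oplus>\<^bsub>?F\<^esub> g) s = f s \<oplus>\<^bsub>K\<^esub> g s" for s by (simp add: free_space_def)
    have "free_lift K U \<psi> (f \<oplus>\<^bsub>?F\<^esub> g) = (\<Oplus>\<^bsub>U\<^esub>s\<in>?T. (f s \<oplus>\<^bsub>K\<^esub> g s) \<odot>\<^bsub>U\<^esub> \<psi> s)"
      by (subst ext[OF fg T]) (auto simp: s)
    also have "\<dots> = (\<Oplus>\<^bsub>U\<^esub>s\<in>?T. f s \<odot>\<^bsub>U\<^esub> \<psi> s \<oplus>\<^bsub>U\<^esub> g s \<odot>\<^bsub>U\<^esub> \<psi> s)"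
      by (rule U.M.finsum_cong') (use T psi fc f g in \<open>auto simp: U.smult_l_distr\<close>)
    also have "\<dots> = (\<Oplus>\<^bsub>U\<^esub>s\<in>?T. f s \<odot>\<^bsub>U\<^esub> \<psi> s) \<oplus>\<^bsub>U\<^esub> (\<Oplus>\<^bsub>U\<^esub>s\<in>?T. g s \<odot>\<^bsub>U\<^esub> \<psi> s)"
      by (rule U.M.finsum_addf) (use T psi fc f g in auto)
    also have "\<dots> = free_lift K U \<psi> f \<oplus>\<^bsub>U\<^esub> free_lift K U \<psi> g"
      using ext[OF f T] ext[OF g T] by simp
    finally show "free_lift K U \<psi> (f \<oplus>\<^bsub>?F\<^esub> g) = free_lift K U \<psi> f \<oplus>\<^bsub>U\<^esub> free_lift K U \<psi> g" .
  next
    fix c f assume c: "c \<in> carrier K" and f: "f \<in> carrier ?F"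
    let ?T = "{s. f s \<noteq> \<zero>\<^bsub>K\<^esub>}"
    have T: "finite ?T" "?T \<subseteq> S" using fin sub f by blast+
    have cf: "c \<odot>\<^bsub>?F\<^esub> f \<in> carrier ?F" using c f by simp
    have s: "(c \<odot>\<^bsub>?F\<^esub> f) s = c \<otimes>\<^bsub>K\<^esub> f s" for s by (simp add: free_space_def)
    have "free_lift K U \<psi> (c \<odot>\<^bsub>?F\<^esub> f) = (\<Oplus>\<^bsub>U\<^esub>s\<in>?T. (c \<otimes>\<^bsub>K\<^esub> f s) \<odot>\<^bsub>U\<^esub> \<psi> s)"
      by (subst ext[OF cf T]) (use c in \<open>auto simp: s\<close>)
    also have "\<dots> = (\<Oplus>\<^bsub>U\<^esub>s\<in>?T. c \<odot>\<^bsub>U\<^esub> (f s \<odot>\<^bsub>U\<^esub> \<psi> s))"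
      by (rule U.M.finsum_cong') (use T psi fc c f in \<open>auto simp: U.smult_assoc1\<close>)
    also have "\<dots> = c \<odot>\<^bsub>U\<^esub> free_lift K U \<psi> f"
      unfolding free_lift_def
      by (rule U.finsum_smult_ldistr[symmetric]) (use T psi fc c f in auto)
    finally show "free_lift K U \<psi> (c \<odot>\<^bsub>?F\<^esub> f) = c \<odot>\<^bsub>U\<^esub> free_lift K U \<psi> f" .
  qed
  fix s assume s: "s \<in> S"
  have "free_lift K U \<psi> (free_gen K s) = (\<Oplus>\<^bsub>U\<^esub>t\<in>{s}. free_gen K s t \<odot>\<^bsub>U\<^esub> \<psi> t)"
    by (rule ext[OF free_gen_closed[OF U.field_axioms s]]) (use s in \<open>auto simp: free_gen_def\<close>)
  also have "\<dots> = \<psi> s" using psi[OF s] by (simp add: free_gen_def)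
  finally show "free_lift K U \<psi> (free_gen K s) = \<psi> s" .
qed

lemma tens_rels_closed:
  assumes V: "vectorspace K V" and W: "vectorspace K W"
  shows "tens_rels K V W \<subseteq> carrier (free_space K (carrier V \<times> carrier W))"
proof -
  interpret V: vectorspace K V by fact
  interpret W: vectorspace K W by fact
  interpret F: vectorspace K "free_space K (carrier V \<times> carrier W)"
    by (rule free_space_vs[OF V.field_axioms])
  have [simp]: "free_gen K (v, w) \<in> carrier (free_space K (carrier V \<times> carrier W))"
    if "v \<in> carrier V" "w \<in> carrier W" for v w
    by (rule free_gen_closed[OF V.field_axioms]) (use that in simp)
  show ?thesis by (auto simp: tens_rels_def Let_def)
qed

lemma tens_quot:
  assumes V: "vectorspace K V" and W: "vectorspace K W"
  shows "quot K (free_space K (carrier V \<times> carrier W)) (tens_null K V W)"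
proof -
  interpret V: vectorspace K V by fact
  interpret F: vectorspace K "free_space K (carrier V \<times> carrier W)"
    by (rule free_space_vs[OF V.field_axioms])
  show ?thesis
    by (intro quot.intro quot_axioms.intro F.vectorspace_axioms)
      (simp add: tens_null_def F.span_is_submodule tens_rels_closed[OF V W])
qed

lemma tens_vs:
  assumes "vectorspace K V" "vectorspace K W"
  shows "vectorspace K (tens K V W)"
  unfolding tens_def using quot.quot_vs[OF tens_quot[OF assms]] .

lemma ptens_bilinear:
  assumes V: "vectorspace K V" and W: "vectorspace K W"
  shows "\<And>v w. v \<in> carrier V \<Longrightarrow> w \<in> carrier W \<Longrightarrow> ptens K V W v w \<in> carrier (tens K V W)"
    and "\<And>v v' w. v \<in> carrier V \<Longrightarrow> v' \<in> carrier V \<Longrightarrow> w \<in> carrier W \<Longrightarrow>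
      ptens K V W (v \<oplus>\<^bsub>V\<^esub> v') w = ptens K V W v w \<oplus>\<^bsub>tens K V W\<^esub> ptens K V W v' w"
    and "\<And>v w w'. v \<in> carrier V \<Longrightarrow> w \<in> carrier W \<Longrightarrow> w' \<in> carrier W \<Longrightarrow>
      ptens K V W v (w \<oplus>\<^bsub>W\<^esub> w') = ptens K V W v w \<oplus>\<^bsub>tens K V W\<^esub> ptens K V W v w'"
    and "\<And>c v w. c \<in> carrier K \<Longrightarrow> v \<in> carrier V \<Longrightarrow> w \<in> carrier W \<Longrightarrow>
      ptens K V W (c \<odot>\<^bsub>V\<^esub> v) w = c \<odot>\<^bsub>tens K V W\<^esub> ptens K V W v w"
    and "\<And>c v w. c \<in> carrier K \<Longrightarrow> v \<in> carrier V \<Longrightarrow> w \<in> carrier W \<Longrightarrow>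
      ptens K V W v (c \<odot>\<^bsub>W\<^esub> w) = c \<odot>\<^bsub>tens K V W\<^esub> ptens K V W v w"
proof -
  interpret V: vectorspace K V by fact
  interpret W: vectorspace K W by fact
  let ?F = "free_space K (carrier V \<times> carrier W)"
  interpret F: vectorspace K ?F by (rule free_space_vs[OF V.field_axioms])
  interpret Q: quot K ?F "tens_null K V W" by (rule tens_quot[OF V W])
  have [simp]: "free_gen K (v, w) \<in> carrier ?F" if "v \<in> carrier V" "w \<in> carrier W" for v w
    by (rule free_gen_closed[OF V.field_axioms]) (use that in simp)
  have rel: "x \<in> tens_null K V W" if "x \<in> tens_rels K V W" for x
    unfolding tens_null_def using F.in_own_span[OF tens_rels_closed[OF V W]] that by blast
  note simps = ptens_def tens_def Q.addQ Q.smultQ Q.coset_eq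
  show "ptens K V W v w \<in> carrier (tens K V W)" if "v \<in> carrier V" "w \<in> carrier W" for v w
    using that by (simp add: ptens_def tens_def Q.carrierQ)
  show "ptens K V W (v \<oplus>\<^bsub>V\<^esub> v') w = ptens K V W v w \<oplus>\<^bsub>tens K V W\<^esub> ptens K V W v' w"
    if "v \<in> carrier V" "v' \<in> carrier V" "w \<in> carrier W" for v v' w
    using that by (simp add: simps) (rule rel, unfold tens_rels_def Let_def, blast)
  show "ptens K V W v (w \<oplus>\<^bsub>W\<^esub> w') = ptens K V W v w \<oplus>\<^bsub>tens K V W\<^esub> ptens K V W v w'"
    if "v \<in> carrier V" "w \<in> carrier W" "w' \<in> carrier W" for v w w'
    using that by (simp add: simps) (rule rel, unfold tens_rels_def Let_def, blast)
  show "ptens K V W (c \<odot>\<^bsub>V\<^esub> v) w = c \<odot>\<^bsub>tens K V W\<^esub> ptens K V W v w"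
    if "c \<in> carrier K" "v \<in> carrier V" "w \<in> carrier W" for c v w
    using that by (simp add: simps) (rule rel, unfold tens_rels_def Let_def, blast)
  show "ptens K V W v (c \<odot>\<^bsub>W\<^esub> w) = c \<odot>\<^bsub>tens K V W\<^esub> ptens K V W v w"
    if "c \<in> carrier K" "v \<in> carrier V" "w \<in> carrier W" for c v w
    using that by (simp add: simps) (rule rel, unfold tens_rels_def Let_def, blast)
qed

lemma tens_ext:
  assumes V: "vectorspace K V" and W: "vectorspace K W"
    and f: "linear_map K (tens K V W) U f" and g: "linear_map K (tens K V W) U g"
    and eq: "\<And>v w. v \<in> carrier V \<Longrightarrow> w \<in> carrier W \<Longrightarrow> f (ptens K V W v w) = g (ptens K V W v w)"
    and x: "x \<in> carrier (tens K V W)"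
  shows "f x = g x"
proof -
  interpret V: vectorspace K V by fact
  let ?F = "free_space K (carrier V \<times> carrier W)"
  let ?N = "tens_null K V W"
  interpret F: vectorspace K ?F by (rule free_space_vs[OF V.field_axioms])
  interpret Q: quot K ?F ?N by (rule tens_quot[OF V W])
  interpret f: linear_map K "tens K V W" U f by fact
  interpret g: linear_map K "tens K V W" U g by fact
  let ?P = "{y \<in> carrier ?F. f (?N +>\<^bsub>?F\<^esub> y) = g (?N +>\<^bsub>?F\<^esub> y)}"
  have cl: "?N +>\<^bsub>?F\<^esub> y \<in> carrier (tens K V W)" if "y \<in> carrier ?F" for y
    using that by (simp add: tens_def Q.carrierQ)
  have add: "?N +>\<^bsub>?F\<^esub> (y \<oplus>\<^bsub>?F\<^esub> z) = (?N +>\<^bsub>?F\<^esub> y) \<oplus>\<^bsub>tens K V W\<^esub> (?N +>\<^bsub>?F\<^esub> z)"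
    if "y \<in> carrier ?F" "z \<in> carrier ?F" for y z
    using that by (simp add: tens_def Q.addQ)
  have smult: "?N +>\<^bsub>?F\<^esub> (c \<odot>\<^bsub>?F\<^esub> y) = c \<odot>\<^bsub>tens K V W\<^esub> (?N +>\<^bsub>?F\<^esub> y)"
    if "c \<in> carrier K" "y \<in> carrier ?F" for c y
    using that by (simp add: tens_def Q.smultQ)
  have zero: "?N +>\<^bsub>?F\<^esub> \<zero>\<^bsub>?F\<^esub> = \<zero>\<^bsub>tens K V W\<^esub>" by (simp add: tens_def Q.zeroQ)
  have "submodule K ?P ?F"
    by (rule submodule.intro) (auto simp: F.module_axioms add smult zero cl)
  moreover have "free_gen K s \<in> ?P" if "s \<in> carrier V \<times> carrier W" for s
    using that eq free_gen_closed[OF V.field_axioms that] by (auto simp: ptens_def)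
  moreover obtain y where "y \<in> carrier ?F" "x = ?N +>\<^bsub>?F\<^esub> y"
    using x by (auto simp: tens_def Q.carrierQ)
  ultimately show ?thesis using free_space_induct[OF V.field_axioms] by blast
qed

lemma tlift:
  assumes V: "vectorspace K V" and W: "vectorspace K W" and U: "vectorspace K U"
    and closed: "\<And>v w. v \<in> carrier V \<Longrightarrow> w \<in> carrier W \<Longrightarrow> \<phi> v w \<in> carrier U"
    and add_l: "\<And>v v' w. v \<in> carrier V \<Longrightarrow> v' \<in> carrier V \<Longrightarrow> w \<in> carrier W \<Longrightarrow>
      \<phi> (v \<oplus>\<^bsub>V\<^esub> v') w = \<phi> v w \<oplus>\<^bsub>U\<^esub> \<phi> v' w"
    and add_r: "\<And>v w w'. v \<in> carrier V \<Longrightarrow> w \<in> carrier W \<Longrightarrow> w' \<in> carrier W \<Longrightarrow>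
      \<phi> v (w \<oplus>\<^bsub>W\<^esub> w') = \<phi> v w \<oplus>\<^bsub>U\<^esub> \<phi> v w'"
    and smult_l: "\<And>c v w. c \<in> carrier K \<Longrightarrow> v \<in> carrier V \<Longrightarrow> w \<in> carrier W \<Longrightarrow>
      \<phi> (c \<odot>\<^bsub>V\<^esub> v) w = c \<odot>\<^bsub>U\<^esub> \<phi> v w"
    and smult_r: "\<And>c v w. c \<in> carrier K \<Longrightarrow> v \<in> carrier V \<Longrightarrow> w \<in> carrier W \<Longrightarrow>
      \<phi> v (c \<odot>\<^bsub>W\<^esub> w) = c \<odot>\<^bsub>U\<^esub> \<phi> v w"
  shows "linear_map K (tens K V W) U (tlift K V W U \<phi>)"
    and "\<And>v w. v \<in> carrier V \<Longrightarrow> w \<in> carrier W \<Longrightarrow> tlift K V W U \<phi> (ptens K V W v w) = \<phi> v w"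
proof -
  interpret V: vectorspace K V by fact
  interpret W: vectorspace K W by fact
  interpret U: vectorspace K U by fact
  let ?F = "free_space K (carrier V \<times> carrier W)"
  let ?N = "tens_null K V W"
  let ?T = "tens K V W"
  interpret F: vectorspace K ?F by (rule free_space_vs[OF V.field_axioms])
  interpret Q: quot K ?F ?N by (rule tens_quot[OF V W])
  have fg [simp]: "free_gen K (v, w) \<in> carrier ?F" if "v \<in> carrier V" "w \<in> carrier W" for v w
    by (rule free_gen_closed[OF V.field_axioms]) (use that in simp)
  define g where "g = free_lift K U (\<lambda>(v, w). \<phi> v w)"
  have "linear_map K ?F U g" unfolding g_def by (rule free_lift(1)[OF U]) (auto simp: closed)
  then interpret g: linear_map K ?F U g .
  have g_gen [simp]: "g (free_gen K (v, w)) = \<phi> v w" if "v \<in> carrier V" "w \<in> carrier W" for v w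
    unfolding g_def using free_lift(2)[OF U, of "carrier V \<times> carrier W" "\<lambda>(v, w). \<phi> v w" "(v, w)"] that
    by (auto simp: closed)
  have minus: "g (x \<ominus>\<^bsub>?F\<^esub> y) = \<zero>\<^bsub>U\<^esub>" if "x \<in> carrier ?F" "y \<in> carrier ?F" "g x = g y" for x y
    using that by (simp add: a_minus_def U.M.r_neg)
  have "tens_rels K V W \<subseteq> g.ker"
    unfolding g.ker_def tens_rels_def Let_def
    by (auto simp: minus add_l add_r smult_l smult_r closed a_minus_def U.M.r_neg)
  then have "?N \<subseteq> g.ker"
    unfolding tens_null_def by (rule F.span_is_subset[OF _ g.ker_is_submodule])
  then have g0: "g x = \<zero>\<^bsub>U\<^esub>" if "x \<in> ?N" for x using that by (auto simp: g.ker_def)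
  have g_coset: "g x = g y" if "x \<in> carrier ?F" "y \<in> carrier ?F" "?N +>\<^bsub>?F\<^esub> x = ?N +>\<^bsub>?F\<^esub> y" for x y
  proof -
    have "g (x \<ominus>\<^bsub>?F\<^esub> y) = \<zero>\<^bsub>U\<^esub>" using g0 Q.coset_eq that by blast
    then have "g x \<oplus>\<^bsub>U\<^esub> \<ominus>\<^bsub>U\<^esub> g y = \<zero>\<^bsub>U\<^esub>" using that by (simp add: a_minus_def)
    then show ?thesis using that by (metis U.M.minus_equality U.M.minus_minus U.M.a_inv_closed g.f_im)
  qed
  define h where "h = restrict (\<lambda>X. g (SOME x. x \<in> carrier ?F \<and> X = ?N +>\<^bsub>?F\<^esub> x)) (carrier ?T)"
  have cT: "carrier ?T = (\<lambda>x. ?N +>\<^bsub>?F\<^esub> x) ` carrier ?F" by (simp add: tens_def Q.carrierQ)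
  have h_coset: "h (?N +>\<^bsub>?F\<^esub> x) = g x" if x: "x \<in> carrier ?F" for x
  proof -
    have "\<exists>y. y \<in> carrier ?F \<and> ?N +>\<^bsub>?F\<^esub> x = ?N +>\<^bsub>?F\<^esub> y" using x by blast
    note y = someI_ex[OF this]
    have "?N +>\<^bsub>?F\<^esub> x \<in> carrier ?T" unfolding cT using x by (rule imageI)
    then have "h (?N +>\<^bsub>?F\<^esub> x) = g (SOME y. y \<in> carrier ?F \<and> ?N +>\<^bsub>?F\<^esub> x = ?N +>\<^bsub>?F\<^esub> y)"
      unfolding h_def by (rule restrict_apply')
    also have "\<dots> = g x" by (rule g_coset[symmetric]) (use x y in blast)+
    finally show ?thesis .
  qed
  have hl: "linear_map K ?T U h"
  proof (rule linear_mapI[OF tens_vs[OF V W] U])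
    show "h X \<in> carrier U" if X: "X \<in> carrier ?T" for X
    proof -
      obtain x where "x \<in> carrier ?F" "X = ?N +>\<^bsub>?F\<^esub> x" using X unfolding cT by (rule imageE)
      then show ?thesis using h_coset g.f_im by metis
    qed
    show "h (X \<oplus>\<^bsub>?T\<^esub> Y) = h X \<oplus>\<^bsub>U\<^esub> h Y" if X: "X \<in> carrier ?T" and Y: "Y \<in> carrier ?T" for X Y
    proof -
      obtain x where x: "x \<in> carrier ?F" "X = ?N +>\<^bsub>?F\<^esub> x" using X unfolding cT by (rule imageE)
      obtain y where y: "y \<in> carrier ?F" "Y = ?N +>\<^bsub>?F\<^esub> y" using Y unfolding cT by (rule imageE)
      have "X \<oplus>\<^bsub>?T\<^esub> Y = ?N +>\<^bsub>?F\<^esub> (x \<oplus>\<^bsub>?F\<^esub> y)" unfolding x(2) y(2) tens_def by (rule Q.addQ[OF x(1) y(1)])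
      then show ?thesis using x y h_coset F.M.a_closed g.f_add by metis
    qed
    show "h (c \<odot>\<^bsub>?T\<^esub> X) = c \<odot>\<^bsub>U\<^esub> h X" if c: "c \<in> carrier K" and X: "X \<in> carrier ?T" for c X
    proof -
      obtain x where x: "x \<in> carrier ?F" "X = ?N +>\<^bsub>?F\<^esub> x" using X unfolding cT by (rule imageE)
      have "c \<odot>\<^bsub>?T\<^esub> X = ?N +>\<^bsub>?F\<^esub> (c \<odot>\<^bsub>?F\<^esub> x)" unfolding x(2) tens_def by (rule Q.smultQ[OF c x(1)])
      then show ?thesis using x c h_coset F.smult_closed g.f_smult by metis
    qed
  qed
  have hp: "h (ptens K V W v w) = \<phi> v w" if "v \<in> carrier V" "w \<in> carrier W" for v w
    using that by (simp add: ptens_def h_coset)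
  have "tlift K V W U \<phi> = h"
    unfolding tlift_def
  proof (rule the_equality)
    show "h \<in> extensional (carrier ?T) \<and> linear_map K ?T U h \<and>
        (\<forall>v\<in>carrier V. \<forall>w\<in>carrier W. h (ptens K V W v w) = \<phi> v w)"
      using hl hp by (auto simp: h_def)
    fix h' assume h': "h' \<in> extensional (carrier ?T) \<and> linear_map K ?T U h' \<and>
        (\<forall>v\<in>carrier V. \<forall>w\<in>carrier W. h' (ptens K V W v w) = \<phi> v w)"
    show "h' = h"
    proof (rule extensionalityI[of _ "carrier ?T"])
      show "h' \<in> extensional (carrier ?T)" using h' by blast
      show "h \<in> extensional (carrier ?T)" by (simp add: h_def)
      show "h' x = h x" if "x \<in> carrier ?T" for x
        by (rule tens_ext[OF V W _ hl _ that]) (use h' hp in auto)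
    qed
  qed
  then show "linear_map K ?T U (tlift K V W U \<phi>)"
    and "\<And>v w. v \<in> carrier V \<Longrightarrow> w \<in> carrier W \<Longrightarrow> tlift K V W U \<phi> (ptens K V W v w) = \<phi> v w"
    using hl hp by auto
qed


lemma tmap:
  assumes V: "vectorspace K V" and W: "vectorspace K W"
    and f: "linear_map K V V' f" and g: "linear_map K W W' g"
  shows "linear_map K (tens K V W) (tens K V' W') (tmap K V W V' W' f g)"
    and "\<And>v w. v \<in> carrier V \<Longrightarrow> w \<in> carrier W \<Longrightarrow>
      tmap K V W V' W' f g (ptens K V W v w) = ptens K V' W' (f v) (g w)"
proof -
  interpret f: linear_map K V V' f by fact
  interpret g: linear_map K W W' g by fact
  have V': "vectorspace K V'" and W': "vectorspace K W'"
    by (rule f.W.vectorspace_axioms, rule g.W.vectorspace_axioms)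
  show "linear_map K (tens K V W) (tens K V' W') (tmap K V W V' W' f g)"
    unfolding tmap_def
    by (rule tlift(1)[OF V W tens_vs[OF V' W']]) (simp_all add: ptens_bilinear[OF V' W'])
  show "tmap K V W V' W' f g (ptens K V W v w) = ptens K V' W' (f v) (g w)"
    if "v \<in> carrier V" "w \<in> carrier W" for v w
    unfolding tmap_def
    by (rule tlift(2)[OF V W tens_vs[OF V' W']]) (simp_all add: ptens_bilinear[OF V' W'] that)
qed

lemma tflip:
  assumes V: "vectorspace K V" and W: "vectorspace K W"
  shows "linear_map K (tens K V W) (tens K W V) (tflip K V W)"
    and "\<And>v w. v \<in> carrier V \<Longrightarrow> w \<in> carrier W \<Longrightarrow>
      tflip K V W (ptens K V W v w) = ptens K W V w v"
  unfolding tflip_def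
  by (rule tlift[OF V W tens_vs[OF W V]]; simp add: ptens_bilinear[OF W V])+

lemma linear_map_add:
  "linear_map K V W f \<Longrightarrow> x \<in> carrier V \<Longrightarrow> y \<in> carrier V \<Longrightarrow> f (x \<oplus>\<^bsub>V\<^esub> y) = f x \<oplus>\<^bsub>W\<^esub> f y"
  and linear_map_smult:
  "linear_map K V W f \<Longrightarrow> c \<in> carrier K \<Longrightarrow> x \<in> carrier V \<Longrightarrow> f (c \<odot>\<^bsub>V\<^esub> x) = c \<odot>\<^bsub>W\<^esub> f x"
  and linear_map_closed:
  "linear_map K V W f \<Longrightarrow> x \<in> carrier V \<Longrightarrow> f x \<in> carrier W"
  by (auto simp: linear_map_def mod_hom_def mod_hom_axioms_def module_hom_def)

lemma linear_mapI_pointwise: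
  assumes "vectorspace K V" "vectorspace K U"
    and "linear_map K V U f" "linear_map K V U g"
  shows "linear_map K V U (\<lambda>x. f x \<oplus>\<^bsub>U\<^esub> g x)"
    and "c \<in> carrier K \<Longrightarrow> linear_map K V U (\<lambda>x. c \<odot>\<^bsub>U\<^esub> f x)"
proof -
  interpret U: vectorspace K U by fact
  note [simp] = linear_map_closed[OF assms(3)] linear_map_closed[OF assms(4)]
    linear_map_add[OF assms(3)] linear_map_add[OF assms(4)]
    linear_map_smult[OF assms(3)] linear_map_smult[OF assms(4)]
  show "linear_map K V U (\<lambda>x. f x \<oplus>\<^bsub>U\<^esub> g x)"
    by (rule linear_mapI[OF assms(1,2)]) (simp_all add: U.M.a_ac U.smult_r_distr)
  show "linear_map K V U (\<lambda>x. c \<odot>\<^bsub>U\<^esub> f x)" if "c \<in> carrier K"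
    by (rule linear_mapI[OF assms(1,2)])
      (simp_all add: that U.smult_r_distr U.smult_assoc1[symmetric] U.R.m_comm)
qed

lemma assoc_r:
  assumes U: "vectorspace K U" and V: "vectorspace K V" and W: "vectorspace K W"
  shows "linear_map K (tens K (tens K U V) W) (tens K U (tens K V W)) (assoc_r K U V W)"
    and "\<And>u v w. u \<in> carrier U \<Longrightarrow> v \<in> carrier V \<Longrightarrow> w \<in> carrier W \<Longrightarrow>
      assoc_r K U V W (ptens K (tens K U V) W (ptens K U V u v) w)
      = ptens K U (tens K V W) u (ptens K V W v w)"
proof -
  note UV = tens_vs[OF U V] note VW = tens_vs[OF V W] note T = tens_vs[OF U VW]
  let ?T = "tens K U (tens K V W)"
  let ?h = "\<lambda>x w. tlift K U V ?T (\<lambda>u v. ptens K U (tens K V W) u (ptens K V W v w)) x"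
  have h: "linear_map K (tens K U V) ?T (\<lambda>x. ?h x w)"
    and hp: "\<And>u v. u \<in> carrier U \<Longrightarrow> v \<in> carrier V \<Longrightarrow>
      ?h (ptens K U V u v) w = ptens K U (tens K V W) u (ptens K V W v w)"
    if "w \<in> carrier W" for w
    by (rule tlift[OF U V T]; simp add: that ptens_bilinear[OF U VW] ptens_bilinear[OF V W])+
  note P = linear_mapI_pointwise[OF UV T]
  have add: "?h x (w \<oplus>\<^bsub>W\<^esub> w') = ?h x w \<oplus>\<^bsub>?T\<^esub> ?h x w'"
    if x: "x \<in> carrier (tens K U V)" and w: "w \<in> carrier W" "w' \<in> carrier W" for x w w'
  proof -
    interpret W: vectorspace K W by fact
    show ?thesis
      by (rule tens_ext[OF U V h P(1)[OF h h] _ x])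
        (simp_all add: w hp ptens_bilinear[OF U VW] ptens_bilinear[OF V W])
  qed
  have smult: "?h x (c \<odot>\<^bsub>W\<^esub> w) = c \<odot>\<^bsub>?T\<^esub> ?h x w"
    if x: "x \<in> carrier (tens K U V)" and w: "c \<in> carrier K" "w \<in> carrier W" for x c w
  proof -
    interpret W: vectorspace K W by fact
    show ?thesis
      by (rule tens_ext[OF U V h P(2)[OF h[OF w(2)] h[OF w(2)]] _ x])
        (simp_all add: w hp ptens_bilinear[OF U VW] ptens_bilinear[OF V W])
  qed
  note simps = linear_map_closed[OF h] linear_map_add[OF h] linear_map_smult[OF h] add smult
  show "linear_map K (tens K (tens K U V) W) ?T (assoc_r K U V W)"
    unfolding assoc_r_def by (rule tlift(1)[OF UV W T]) (simp_all add: simps)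
  show "assoc_r K U V W (ptens K (tens K U V) W (ptens K U V u v) w)
      = ptens K U (tens K V W) u (ptens K V W v w)"
    if "u \<in> carrier U" "v \<in> carrier V" "w \<in> carrier W" for u v w
    unfolding assoc_r_def using that
    by (subst tlift(2)[OF UV W T]) (simp_all add: simps hp ptens_bilinear[OF U V])
qed

lemma assoc_l:
  assumes U: "vectorspace K U" and V: "vectorspace K V" and W: "vectorspace K W"
  shows "linear_map K (tens K U (tens K V W)) (tens K (tens K U V) W) (assoc_l K U V W)"
    and "\<And>u v w. u \<in> carrier U \<Longrightarrow> v \<in> carrier V \<Longrightarrow> w \<in> carrier W \<Longrightarrow>
      assoc_l K U V W (ptens K U (tens K V W) u (ptens K V W v w))
      = ptens K (tens K U V) W (ptens K U V u v) w"
proof -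
  note UV = tens_vs[OF U V] note VW = tens_vs[OF V W] note T = tens_vs[OF UV W]
  let ?T = "tens K (tens K U V) W"
  let ?h = "\<lambda>u y. tlift K V W ?T (\<lambda>v w. ptens K (tens K U V) W (ptens K U V u v) w) y"
  have h: "linear_map K (tens K V W) ?T (\<lambda>y. ?h u y)"
    and hp: "\<And>v w. v \<in> carrier V \<Longrightarrow> w \<in> carrier W \<Longrightarrow>
      ?h u (ptens K V W v w) = ptens K (tens K U V) W (ptens K U V u v) w"
    if "u \<in> carrier U" for u
    by (rule tlift[OF V W T]; simp add: that ptens_bilinear[OF UV W] ptens_bilinear[OF U V])+
  note P = linear_mapI_pointwise[OF VW T]
  have add: "?h (u \<oplus>\<^bsub>U\<^esub> u') y = ?h u y \<oplus>\<^bsub>?T\<^esub> ?h u' y"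
    if y: "y \<in> carrier (tens K V W)" and u: "u \<in> carrier U" "u' \<in> carrier U" for y u u'
  proof -
    interpret U: vectorspace K U by fact
    show ?thesis
      by (rule tens_ext[OF V W h P(1)[OF h h] _ y])
        (simp_all add: u hp ptens_bilinear[OF UV W] ptens_bilinear[OF U V])
  qed
  have smult: "?h (c \<odot>\<^bsub>U\<^esub> u) y = c \<odot>\<^bsub>?T\<^esub> ?h u y"
    if y: "y \<in> carrier (tens K V W)" and u: "c \<in> carrier K" "u \<in> carrier U" for y c u
  proof -
    interpret U: vectorspace K U by fact
    show ?thesis
      by (rule tens_ext[OF V W h P(2)[OF h[OF u(2)] h[OF u(2)]] _ y])
        (simp_all add: u hp ptens_bilinear[OF UV W] ptens_bilinear[OF U V])
  qed
  note simps = linear_map_closed[OF h] linear_map_add[OF h] linear_map_smult[OF h] add smult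
  show "linear_map K (tens K U (tens K V W)) ?T (assoc_l K U V W)"
    unfolding assoc_l_def by (rule tlift(1)[OF U VW T]) (simp_all add: simps)
  show "assoc_l K U V W (ptens K U (tens K V W) u (ptens K V W v w))
      = ptens K (tens K U V) W (ptens K U V u v) w"
    if "u \<in> carrier U" "v \<in> carrier V" "w \<in> carrier W" for u v w
    unfolding assoc_l_def using that
    by (subst tlift(2)[OF U VW T]) (simp_all add: simps hp ptens_bilinear[OF V W])
qed

lemma linear_map_id: "vectorspace K V \<Longrightarrow> linear_map K V V id"
  by (rule linear_mapI) auto

lemma mid_map_ptens:
  assumes U: "vectorspace K U" and V: "vectorspace K V" and W: "vectorspace K W"
    and X: "vectorspace K X" and V': "vectorspace K V'" and W': "vectorspace K W'"
    and f: "linear_map K (tens K V W) (tens K V' W') f"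
    and el: "u \<in> carrier U" "v \<in> carrier V" "w \<in> carrier W" "x \<in> carrier X"
      "v' \<in> carrier V'" "w' \<in> carrier W'"
    and eq: "f (ptens K V W v w) = ptens K V' W' v' w'"
  shows "mid_map K U V W X V' W' f (ptens K (tens K U V) (tens K W X) (ptens K U V u v) (ptens K W X w x))
    = ptens K (tens K U V') (tens K W' X) (ptens K U V' u v') (ptens K W' X w' x)"
proof -
  note VW = tens_vs[OF V W] note WX = tens_vs[OF W X] note VW' = tens_vs[OF V' W']
  note W'X = tens_vs[OF W' X]
  note VWX = tens_vs[OF V WX] note VW_X = tens_vs[OF VW X]
  note VW_X' = tens_vs[OF VW' X] note VWX' = tens_vs[OF V' W'X]
  note id = linear_map_id
  note pc = ptens_bilinear(1)
  have wx: "ptens K W X w x \<in> carrier (tens K W X)" using pc[OF W X] el by blast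
  have vw: "ptens K V W v w \<in> carrier (tens K V W)" using pc[OF V W] el by blast
  have vw': "ptens K V' W' v' w' \<in> carrier (tens K V' W')" using pc[OF V' W'] el by blast
  have v_wx: "ptens K V (tens K W X) v (ptens K W X w x) \<in> carrier (tens K V (tens K W X))"
    using pc[OF V WX el(2) wx] .
  have vw_x: "ptens K (tens K V W) X (ptens K V W v w) x \<in> carrier (tens K (tens K V W) X)"
    using pc[OF VW X vw el(4)] .
  have vw_x': "ptens K (tens K V' W') X (ptens K V' W' v' w') x \<in> carrier (tens K (tens K V' W') X)"
    using pc[OF VW' X vw' el(4)] .
  have w'x: "ptens K W' X w' x \<in> carrier (tens K W' X)" using pc[OF W' X] el by blast
  note fi = tmap[OF VW X f id[OF X]]
  note s1 = assoc_r(2)[OF U V WX el(1,2) wx]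
  note s2 = tmap(2)[OF U VWX id[OF U] assoc_l(1)[OF V W X] el(1) v_wx]
  note s3 = tmap(2)[OF U VW_X id[OF U] fi(1) el(1) vw_x]
  note s4 = tmap(2)[OF U VW_X' id[OF U] assoc_r(1)[OF V' W' X] el(1) vw_x']
  show ?thesis
    unfolding mid_map_def o_apply s1 s2 id_apply assoc_l(2)[OF V W X el(2-4)] s3
      fi(2)[OF vw el(4)] eq s4 assoc_r(2)[OF V' W' X el(5,6,4)]
    by (rule assoc_l(2)[OF U V' W'X el(1,5) w'x])
qed

end

theory Submission
  imports Defs
begin

text \<open>
  Write \<open>H\<close> for the twisted tensor product and suppose it is a bialgebra. In \<open>H\<close> the product
  \<open>(1 \<otimes> b)(a \<otimes> 1)\<close> is \<open>\<tau>(b \<otimes> a)\<close>, and \<open>\<Delta>\<^sub>H\<close> restricts to \<open>\<Delta>\<^sub>A\<close> and \<open>\<Delta>\<^sub>B\<close> on the two factors, so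
  multiplicativity of \<open>\<Delta>\<^sub>H\<close> reads
  \<open>(\<Delta>\<^sub>A \<otimes> \<Delta>\<^sub>B) \<tau>(b \<otimes> a) = (1 \<otimes> \<tau> \<otimes> 1)(\<tau>(b\<^sub>1 \<otimes> a\<^sub>1) \<otimes> \<tau>(b\<^sub>2 \<otimes> a\<^sub>2))\<close>.
  Applying \<open>\<epsilon> \<otimes> 1 \<otimes> 1 \<otimes> \<epsilon>\<close> and cancelling \<open>\<tau>\<close> gives
  \<open>b \<otimes> a = (\<epsilon> \<otimes> 1) \<tau>(b\<^sub>1 \<otimes> a\<^sub>1) \<otimes> (1 \<otimes> \<epsilon>) \<tau>(b\<^sub>2 \<otimes> a\<^sub>2)\<close>. Since \<open>\<epsilon>\<^sub>H \<tau> = \<epsilon>\<^sub>B \<otimes> \<epsilon>\<^sub>A\<close>, a further counit on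
  either side yields \<open>(1 \<otimes> \<epsilon>) \<tau>(b \<otimes> a) = \<epsilon>(b) a\<close> and \<open>(\<epsilon> \<otimes> 1) \<tau>(b \<otimes> a) = \<epsilon>(a) b\<close>. Applying
  \<open>1 \<otimes> \<epsilon> \<otimes> \<epsilon> \<otimes> 1\<close> to the first identity instead now gives \<open>\<tau>(b \<otimes> a) = a \<otimes> b\<close>. The converse is the
  usual tensor product of bialgebras, verified on pure tensors.
\<close>

section \<open>Calculus of tensor products\<close>

lemma linear_map_compose:
  "linear_map K U V g \<Longrightarrow> linear_map K V W f \<Longrightarrow> linear_map K U W (f \<circ> g)"
  by (auto simp: linear_map_def mod_hom_def mod_hom_axioms_def module_hom_def Pi_iff)

lemma linear_map_inv_into:
  assumes f: "linear_map K V W f" and bij: "bij_betw f (carrier V) (carrier W)"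
  shows "linear_map K W V (inv_into (carrier V) f)"
proof -
  interpret f: linear_map K V W f by fact
  note inv = bij_betw_inv_into_right[OF bij] bij_betw_inv_into_left[OF bij]
  have cl: "inv_into (carrier V) f w \<in> carrier V" if "w \<in> carrier W" for w
    using bij that by (simp add: bij_betw_def inv_into_into)
  show ?thesis
  proof (rule linear_mapI[OF f.W.vectorspace_axioms f.V.vectorspace_axioms cl])
    show "inv_into (carrier V) f (x \<oplus>\<^bsub>W\<^esub> y) = inv_into (carrier V) f x \<oplus>\<^bsub>V\<^esub> inv_into (carrier V) f y"
      if "x \<in> carrier W" "y \<in> carrier W" for x y
      using that inv(2)[of "inv_into (carrier V) f x \<oplus>\<^bsub>V\<^esub> inv_into (carrier V) f y"]
      by (simp add: cl inv(1))
    show "inv_into (carrier V) f (c \<odot>\<^bsub>W\<^esub> x) = c \<odot>\<^bsub>V\<^esub> inv_into (carrier V) f x"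
      if "c \<in> carrier K" "x \<in> carrier W" for c x
      using that inv(2)[of "c \<odot>\<^bsub>V\<^esub> inv_into (carrier V) f x"] by (simp add: cl inv(1))
  qed
qed

text \<open>Sums of pure tensors exhaust the space: a scalar is absorbed by the first factor, and
  zero is itself pure.\<close>

lemma tens_induct:
  assumes V: "vectorspace K V" and W: "vectorspace K W" and x: "x \<in> carrier (tens K V W)"
    and add: "\<And>x y. x \<in> carrier (tens K V W) \<Longrightarrow> y \<in> carrier (tens K V W) \<Longrightarrow>
      P x \<Longrightarrow> P y \<Longrightarrow> P (x \<oplus>\<^bsub>tens K V W\<^esub> y)"
    and pure: "\<And>v w. v \<in> carrier V \<Longrightarrow> w \<in> carrier W \<Longrightarrow> P (ptens K V W v w)"
  shows "P x"
proof -
  interpret V: vectorspace K V by fact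
  interpret W: vectorspace K W by fact
  let ?F = "free_space K (carrier V \<times> carrier W)"
  let ?T = "tens K V W"
  let ?N = "tens_null K V W"
  interpret F: vectorspace K ?F by (rule free_space_vs[OF V.field_axioms])
  interpret T: vectorspace K ?T by (rule tens_vs[OF V W])
  interpret Q: quot K ?F ?N by (rule tens_quot[OF V W])
  have cl: "?N +>\<^bsub>?F\<^esub> y \<in> carrier ?T" if "y \<in> carrier ?F" for y
    using that by (simp add: tens_def Q.carrierQ)
  have addT: "?N +>\<^bsub>?F\<^esub> (y \<oplus>\<^bsub>?F\<^esub> z) = (?N +>\<^bsub>?F\<^esub> y) \<oplus>\<^bsub>?T\<^esub> (?N +>\<^bsub>?F\<^esub> z)"
    if "y \<in> carrier ?F" "z \<in> carrier ?F" for y z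
    using that by (simp add: tens_def Q.addQ)
  have smultT: "?N +>\<^bsub>?F\<^esub> (c \<odot>\<^bsub>?F\<^esub> y) = c \<odot>\<^bsub>?T\<^esub> (?N +>\<^bsub>?F\<^esub> y)"
    if "c \<in> carrier K" "y \<in> carrier ?F" for c y
    using that by (simp add: tens_def Q.smultQ)
  have zeroT: "?N +>\<^bsub>?F\<^esub> \<zero>\<^bsub>?F\<^esub> = \<zero>\<^bsub>?T\<^esub>" by (simp add: tens_def Q.zeroQ)
  \<comment> \<open>Zero is pure: in a tensor of zero vectors the scalar zero can be pulled out of
    the first factor.\<close>
  have P0: "P \<zero>\<^bsub>?T\<^esub>"
  proof -
    have "ptens K V W (\<zero>\<^bsub>K\<^esub> \<odot>\<^bsub>V\<^esub> \<zero>\<^bsub>V\<^esub>) \<zero>\<^bsub>W\<^esub> = \<zero>\<^bsub>?T\<^esub>"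
      by (subst ptens_bilinear(4)[OF V W]) (simp_all add: ptens_bilinear(1)[OF V W])
    then show ?thesis using pure[of "\<zero>\<^bsub>K\<^esub> \<odot>\<^bsub>V\<^esub> \<zero>\<^bsub>V\<^esub>" "\<zero>\<^bsub>W\<^esub>"] by simp
  qed
  \<comment> \<open>Closure of \<open>P\<close> under sums alone does not give the submodule that
    \<open>free_space_induct\<close> requires; demanding \<open>P\<close> for all scalar multiples
    of the coset does.\<close>
  let ?S = "{y \<in> carrier ?F. \<forall>c\<in>carrier K. P (c \<odot>\<^bsub>?T\<^esub> (?N +>\<^bsub>?F\<^esub> y))}"
  have "submodule K ?S ?F"
    by (rule submodule.intro)
      (auto simp: F.module_axioms addT smultT zeroT cl T.smult_r_distr
        T.smult_assoc1[symmetric] P0 intro: add)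
  moreover have "free_gen K s \<in> ?S" if sVW: "s \<in> carrier V \<times> carrier W" for s
  proof -
    obtain v w where s: "s = (v, w)" "v \<in> carrier V" "w \<in> carrier W" using sVW by blast
    have "P (c \<odot>\<^bsub>?T\<^esub> ptens K V W v w)" if "c \<in> carrier K" for c
      using pure[of "c \<odot>\<^bsub>V\<^esub> v" w] that s by (simp add: ptens_bilinear(4)[OF V W])
    then show ?thesis using s free_gen_closed[OF V.field_axioms sVW] by (auto simp: ptens_def)
  qed
  moreover obtain y where y: "y \<in> carrier ?F" "x = ?N +>\<^bsub>?F\<^esub> y"
    using x by (auto simp: tens_def Q.carrierQ)
  ultimately have "y \<in> ?S" using free_space_induct[OF V.field_axioms] by blast
  then have "P (\<one>\<^bsub>K\<^esub> \<odot>\<^bsub>?T\<^esub> x)" using y by simp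
  then show ?thesis using x by simp
qed

text \<open>Serves identities in two separate tensors, such as \<open>deltaB b\<close> and
  \<open>deltaA a\<close>. In place of Sweedler sums these are generalised to arbitrary tensors, and
  additivity in each argument reduces the identity to pure ones.\<close>

lemma tens_induct_pair:
  assumes VS: "vectorspace K U" "vectorspace K V" "vectorspace K W" "vectorspace K X"
    and x: "x \<in> carrier (tens K U V)" and y: "y \<in> carrier (tens K W X)"
    and add_l: "\<And>x x' y. x \<in> carrier (tens K U V) \<Longrightarrow> x' \<in> carrier (tens K U V) \<Longrightarrow>
      y \<in> carrier (tens K W X) \<Longrightarrow> P x y \<Longrightarrow> P x' y \<Longrightarrow> P (x \<oplus>\<^bsub>tens K U V\<^esub> x') y"
    and add_r: "\<And>x y y'. x \<in> carrier (tens K U V) \<Longrightarrow> y \<in> carrier (tens K W X) \<Longrightarrow>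
      y' \<in> carrier (tens K W X) \<Longrightarrow> P x y \<Longrightarrow> P x y' \<Longrightarrow> P x (y \<oplus>\<^bsub>tens K W X\<^esub> y')"
    and pure: "\<And>u v w x. u \<in> carrier U \<Longrightarrow> v \<in> carrier V \<Longrightarrow> w \<in> carrier W \<Longrightarrow> x \<in> carrier X \<Longrightarrow>
      P (ptens K U V u v) (ptens K W X w x)"
  shows "P x y"
  using x
proof (rule tens_induct[OF VS(1,2)])
  fix u v assume uv: "u \<in> carrier U" "v \<in> carrier V"
  show "P (ptens K U V u v) y"
    using y
    by (rule tens_induct[OF VS(3,4)]) (auto intro: add_r pure uv ptens_bilinear(1)[OF VS(1,2)])
qed (rule add_l[OF _ _ y])

lemma tens_tens_induct:
  assumes VS: "vectorspace K U" "vectorspace K V" "vectorspace K W" "vectorspace K X"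
    and x: "x \<in> carrier (tens K (tens K U V) (tens K W X))"
    and add: "\<And>x y. x \<in> carrier (tens K (tens K U V) (tens K W X)) \<Longrightarrow>
      y \<in> carrier (tens K (tens K U V) (tens K W X)) \<Longrightarrow>
      P x \<Longrightarrow> P y \<Longrightarrow> P (x \<oplus>\<^bsub>tens K (tens K U V) (tens K W X)\<^esub> y)"
    and pure: "\<And>u v w x. u \<in> carrier U \<Longrightarrow> v \<in> carrier V \<Longrightarrow> w \<in> carrier W \<Longrightarrow> x \<in> carrier X \<Longrightarrow>
      P (ptens K (tens K U V) (tens K W X) (ptens K U V u v) (ptens K W X w x))"
  shows "P x"
proof -
  note T = tens_vs[OF VS(1,2)] tens_vs[OF VS(3,4)]
  show ?thesis
    using x
  proof (rule tens_induct[OF T])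
    show "P (ptens K (tens K U V) (tens K W X) p q)"
      if "p \<in> carrier (tens K U V)" "q \<in> carrier (tens K W X)" for p q
      using VS that
      by (rule tens_induct_pair) (auto simp: ptens_bilinear[OF T] intro: add pure)
  qed (rule add)
qed

lemma tens_add_closed:
  "vectorspace K V \<Longrightarrow> vectorspace K W \<Longrightarrow> x \<in> carrier (tens K V W) \<Longrightarrow> y \<in> carrier (tens K V W) \<Longrightarrow>
    x \<oplus>\<^bsub>tens K V W\<^esub> y \<in> carrier (tens K V W)"
  and tens_smult_closed:
  "vectorspace K V \<Longrightarrow> vectorspace K W \<Longrightarrow> c \<in> carrier K \<Longrightarrow> x \<in> carrier (tens K V W) \<Longrightarrow>
    c \<odot>\<^bsub>tens K V W\<^esub> x \<in> carrier (tens K V W)"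
  using vectorspace.axioms(1)[OF tens_vs, of K V W]
  by (auto intro: module.smult_closed abelian_groupE(1)[OF module.axioms(2)])

text \<open>Rewrite rules that push the structure maps through sums, scalars and pure tensors. With
  the induction rules they reduce an identity of linear maps to its values on pure tensors.\<close>

lemmas tens_simps = tens_vs tens_add_closed tens_smult_closed ptens_bilinear linear_map_id
  tmap linear_map_closed[OF tmap(1)] linear_map_add[OF tmap(1)] linear_map_smult[OF tmap(1)]
  tflip linear_map_closed[OF tflip(1)] linear_map_add[OF tflip(1)] linear_map_smult[OF tflip(1)]
  assoc_r linear_map_closed[OF assoc_r(1)] linear_map_add[OF assoc_r(1)] linear_map_smult[OF assoc_r(1)]
  assoc_l linear_map_closed[OF assoc_l(1)] linear_map_add[OF assoc_l(1)] linear_map_smult[OF assoc_l(1)]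

text \<open>\<open>tens_insert K U V W X u x\<close> is the map \<open>v \<otimes> w \<mapsto> (u \<otimes> v) \<otimes> (w \<otimes> x)\<close>. It expresses
  \<^const>\<open>mid_map\<close> for maps that do not preserve pure tensors.\<close>

definition tens_insert where
  "tens_insert K U V W X u x y =
     assoc_l K U V (tens K W X)
       (tmap K U (tens K (tens K V W) X) U (tens K V (tens K W X)) id (assoc_r K V W X)
         (ptens K U (tens K (tens K V W) X) u (ptens K (tens K V W) X y x)))"

lemma tens_insert:
  assumes VS: "vectorspace K U" "vectorspace K V" "vectorspace K W" "vectorspace K X"
    and ux: "u \<in> carrier U" "x \<in> carrier X"
  shows "linear_map K (tens K V W) (tens K (tens K U V) (tens K W X)) (tens_insert K U V W X u x)"
    and "\<And>v w. v \<in> carrier V \<Longrightarrow> w \<in> carrier W \<Longrightarrow>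
      tens_insert K U V W X u x (ptens K V W v w)
      = ptens K (tens K U V) (tens K W X) (ptens K U V u v) (ptens K W X w x)"
   apply (rule linear_mapI)
       apply (simp_all add: tens_insert_def tens_simps VS ux)
  done

lemma mid_map:
  assumes VS: "vectorspace K U" "vectorspace K V" "vectorspace K W" "vectorspace K X"
      "vectorspace K V'" "vectorspace K W'"
    and f: "linear_map K (tens K V W) (tens K V' W') f"
  shows "linear_map K (tens K (tens K U V) (tens K W X)) (tens K (tens K U V') (tens K W' X))
      (mid_map K U V W X V' W' f)"
    and "\<And>u v w x. u \<in> carrier U \<Longrightarrow> v \<in> carrier V \<Longrightarrow> w \<in> carrier W \<Longrightarrow> x \<in> carrier X \<Longrightarrow>
      mid_map K U V W X V' W' f
        (ptens K (tens K U V) (tens K W X) (ptens K U V u v) (ptens K W X w x))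
      = tens_insert K U V' W' X u x (f (ptens K V W v w))"
proof -
  show "linear_map K (tens K (tens K U V) (tens K W X)) (tens K (tens K U V') (tens K W' X))
      (mid_map K U V W X V' W' f)"
    unfolding mid_map_def
    by (intro linear_map_compose) (rule tmap assoc_l assoc_r tens_vs linear_map_id VS f)+
  fix u v w x assume [simp]: "u \<in> carrier U" "v \<in> carrier V" "w \<in> carrier W" "x \<in> carrier X"
  show "mid_map K U V W X V' W' f
        (ptens K (tens K U V) (tens K W X) (ptens K U V u v) (ptens K W X w x))
      = tens_insert K U V' W' X u x (f (ptens K V W v w))"
    by (simp add: mid_map_def tens_insert_def tens_simps VS f linear_map_closed[OF f])
qed

text \<open>By additivity in \<open>y\<close> only pure tensors matter, where both sides are known.
  The lemma composes successive middle maps, so that \<open>tau\<close> can cancel its inverse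
  there.\<close>

lemma mid_map_tens_insert:
  assumes VS: "vectorspace K U" "vectorspace K V" "vectorspace K W" "vectorspace K X"
      "vectorspace K V'" "vectorspace K W'"
    and f: "linear_map K (tens K V W) (tens K V' W') f"
    and el: "u \<in> carrier U" "x \<in> carrier X" "y \<in> carrier (tens K V W)"
  shows "mid_map K U V W X V' W' f (tens_insert K U V W X u x y) = tens_insert K U V' W' X u x (f y)"
proof -
  note l = tens_insert(1)[OF VS(1,2,3,4) el(1,2)] tens_insert(1)[OF VS(1,5,6,4) el(1,2)]
    mid_map(1)[OF VS f] f
  show ?thesis
    using el(3)
  proof (rule tens_induct[OF VS(2,3)])
    show "mid_map K U V W X V' W' f (tens_insert K U V W X u x (p \<oplus>\<^bsub>tens K V W\<^esub> q))
        = tens_insert K U V' W' X u x (f (p \<oplus>\<^bsub>tens K V W\<^esub> q))"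
      if "p \<in> carrier (tens K V W)" "q \<in> carrier (tens K V W)"
        "mid_map K U V W X V' W' f (tens_insert K U V W X u x p) = tens_insert K U V' W' X u x (f p)"
        "mid_map K U V W X V' W' f (tens_insert K U V W X u x q) = tens_insert K U V' W' X u x (f q)"
      for p q
      using that by (simp add: l[THEN linear_map_add] l[THEN linear_map_closed])
  qed (simp add: tens_insert(2) mid_map(2) VS f el)
qed

lemmas tens_insert_simps = tens_insert linear_map_closed[OF tens_insert(1)]
  linear_map_add[OF tens_insert(1)] linear_map_smult[OF tens_insert(1)]

lemmas mid_map_simps = mid_map linear_map_closed[OF mid_map(1)]
  linear_map_add[OF mid_map(1)] linear_map_smult[OF mid_map(1)]

section \<open>The ground field and the unit isomorphisms\<close>

lemma carrier_ground [simp]: "carrier (ground K) = carrier K"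
  and add_ground [simp]: "add (ground K) = add K"
  and smult_ground [simp]: "smult (ground K) = mult K"
  and zero_ground [simp]: "zero (ground K) = zero K"
  by (simp_all add: ground_def)

lemma ground_vs: "field K \<Longrightarrow> vectorspace K (ground K)"
proof -
  assume "field K"
  then interpret field K .
  have "module K (ground K)"
    by (rule module_criteria)
      (auto simp: a_ac m_assoc l_distr r_distr is_cring intro: l_neg r_neg)
  then show ?thesis by (simp add: vectorspace_def field_axioms)
qed

lemma lunit:
  assumes V: "vectorspace K V"
  shows "linear_map K (tens K (ground K) V) V (lunit K V)"
    and "\<And>c v. c \<in> carrier K \<Longrightarrow> v \<in> carrier V \<Longrightarrow> lunit K V (ptens K (ground K) V c v) = c \<odot>\<^bsub>V\<^esub> v"
proof -
  interpret vectorspace K V by fact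
  note [simp] = smult_l_distr smult_r_distr
  show "linear_map K (tens K (ground K) V) V (lunit K V)"
    unfolding lunit_def
    by (rule tlift(1)[OF ground_vs[OF field_axioms] V V])
      (simp_all add: smult_assoc1[symmetric] R.m_comm)
  show "lunit K V (ptens K (ground K) V c v) = c \<odot>\<^bsub>V\<^esub> v"
    if "c \<in> carrier K" "v \<in> carrier V" for c v
    unfolding lunit_def
    by (rule tlift(2)[OF ground_vs[OF field_axioms] V V])
      (simp_all add: that smult_assoc1[symmetric] R.m_comm)
qed

lemma runit:
  assumes V: "vectorspace K V"
  shows "linear_map K (tens K V (ground K)) V (runit K V)"
    and "\<And>c v. c \<in> carrier K \<Longrightarrow> v \<in> carrier V \<Longrightarrow> runit K V (ptens K V (ground K) v c) = c \<odot>\<^bsub>V\<^esub> v"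
proof -
  interpret vectorspace K V by fact
  note [simp] = smult_l_distr smult_r_distr
  show "linear_map K (tens K V (ground K)) V (runit K V)"
    unfolding runit_def
    by (rule tlift(1)[OF V ground_vs[OF field_axioms] V])
      (simp_all add: smult_assoc1[symmetric] R.m_comm)
  show "runit K V (ptens K V (ground K) v c) = c \<odot>\<^bsub>V\<^esub> v"
    if "c \<in> carrier K" "v \<in> carrier V" for c v
    unfolding runit_def
    by (rule tlift(2)[OF V ground_vs[OF field_axioms] V])
      (simp_all add: that smult_assoc1[symmetric] R.m_comm)
qed

lemmas unit_simps =
  lunit linear_map_closed[OF lunit(1)] linear_map_add[OF lunit(1)] linear_map_smult[OF lunit(1)]
  runit linear_map_closed[OF runit(1)] linear_map_add[OF runit(1)] linear_map_smult[OF runit(1)]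

lemmas tensor_calculus = tens_simps tens_insert_simps mid_map_simps unit_simps


section \<open>Bialgebras on pure tensors\<close>

context k_algebra
begin

lemmas nabla_simps = nabla_linear linear_map_closed[OF nabla_linear] linear_map_add[OF nabla_linear]
  linear_map_smult[OF nabla_linear]

lemma eta_closed: "c \<in> carrier K \<Longrightarrow> eta c \<in> carrier A"
  using linear_map_closed[OF eta_linear] by simp

lemma eta_add: "c \<in> carrier K \<Longrightarrow> d \<in> carrier K \<Longrightarrow> eta (c \<oplus>\<^bsub>K\<^esub> d) = eta c \<oplus>\<^bsub>A\<^esub> eta d"
  using linear_map_add[OF eta_linear] by simp

lemma nabla_assoc_ptens:
  assumes [simp]: "a \<in> carrier A" "b \<in> carrier A" "c \<in> carrier A"
  shows "nabla (ptens K A A (nabla (ptens K A A a b)) c)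
    = nabla (ptens K A A a (nabla (ptens K A A b c)))"
  using nabla_assoc[of "ptens K (tens K A A) A (ptens K A A a b) c"]
  by (simp add: tensor_calculus vectorspace_axioms nabla_simps)

lemma nabla_eta_left:
  assumes [simp]: "c \<in> carrier K" "a \<in> carrier A"
  shows "nabla (ptens K A A (eta c) a) = c \<odot>\<^bsub>A\<^esub> a"
  using eta_left[of "ptens K (ground K) A c a"]
  by (simp add: tensor_calculus vectorspace_axioms ground_vs[OF field_axioms] eta_linear)

lemma nabla_eta_right:
  assumes [simp]: "c \<in> carrier K" "a \<in> carrier A"
  shows "nabla (ptens K A A a (eta c)) = c \<odot>\<^bsub>A\<^esub> a"
  using eta_right[of "ptens K A (ground K) a c"]
  by (simp add: tensor_calculus vectorspace_axioms ground_vs[OF field_axioms] eta_linear)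

lemmas algebra_calculus = nabla_simps eta_linear eta_closed eta_add nabla_assoc_ptens
  nabla_eta_left nabla_eta_right

end

context k_coalgebra
begin

lemmas delta_simps = delta_linear linear_map_closed[OF delta_linear] linear_map_add[OF delta_linear]

lemma eps_closed: "a \<in> carrier A \<Longrightarrow> eps a \<in> carrier K"
  using linear_map_closed[OF eps_linear] by simp

lemma eps_add: "a \<in> carrier A \<Longrightarrow> b \<in> carrier A \<Longrightarrow> eps (a \<oplus>\<^bsub>A\<^esub> b) = eps a \<oplus>\<^bsub>K\<^esub> eps b"
  using linear_map_add[OF eps_linear] by simp

lemma eps_smult: "c \<in> carrier K \<Longrightarrow> a \<in> carrier A \<Longrightarrow> eps (c \<odot>\<^bsub>A\<^esub> a) = c \<otimes>\<^bsub>K\<^esub> eps a"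
  using linear_map_smult[OF eps_linear] by simp

lemmas coalgebra_calculus = delta_simps eps_linear eps_closed eps_add eps_smult eps_left eps_right

end

context k_bialgebra
begin

lemma delta_nabla_ptens:
  assumes [simp]: "a \<in> carrier A" "b \<in> carrier A"
  shows "delta (nabla (ptens K A A a b))
    = tmap K (tens K A A) (tens K A A) A A nabla nabla
        (mid_map K A A A A A A (tflip K A A) (ptens K (tens K A A) (tens K A A) (delta a) (delta b)))"
  using delta_nabla[of "ptens K A A a b"]
  by (simp add: tensor_calculus vectorspace_axioms delta_linear)

lemma delta_eta_ptens:
  assumes [simp]: "c \<in> carrier K"
  shows "delta (eta c) = ptens K A A (eta c) (eta \<one>\<^bsub>K\<^esub>)"
  using delta_eta[of c]
  by (simp add: tensor_calculus vectorspace_axioms ground_split_def ground_vs[OF field_axioms]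
      eta_linear)

lemma eps_nabla_ptens:
  assumes [simp]: "a \<in> carrier A" "b \<in> carrier A"
  shows "eps (nabla (ptens K A A a b)) = eps a \<otimes>\<^bsub>K\<^esub> eps b"
  using eps_nabla[of "ptens K A A a b"]
  by (simp add: tensor_calculus vectorspace_axioms ground_vs[OF field_axioms] eps_linear eps_closed)

lemmas bialgebra_calculus = algebra_calculus coalgebra_calculus delta_nabla_ptens delta_eta_ptens
  eps_nabla_ptens eps_eta

end

section \<open>Structure maps of the twisted tensor product\<close>

locale twisted_bialgebras = twisting_map K A nablaA etaA B nablaB etaB tau +
  A: k_bialgebra K A nablaA etaA deltaA epsA + B: k_bialgebra K B nablaB etaB deltaB epsB
  for K :: "('k, 'r) ring_scheme"
    and A :: "('k, 'a, 'm) module_scheme" and nablaA etaA deltaA epsA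
    and B :: "('k, 'b, 'n) module_scheme" and nablaB etaB deltaB epsB
    and tau
begin

lemmas calculus [simp] = tensor_calculus A.bialgebra_calculus B.bialgebra_calculus
  A.vectorspace_axioms B.vectorspace_axioms ground_vs[OF A.field_axioms]
  tau_linear linear_map_closed[OF tau_linear] linear_map_add[OF tau_linear]
  linear_map_smult[OF tau_linear] tau_unit_A tau_unit_B

abbreviation "tau_inv \<equiv> inv_into (carrier (tens K B A)) tau"

lemmas tau_inv_linear = linear_map_inv_into[OF tau_linear tau_bij]

lemmas tau_inv_simps [simp] = tau_inv_linear linear_map_closed[OF tau_inv_linear]
  linear_map_add[OF tau_inv_linear] bij_betw_inv_into_left[OF tau_bij] bij_betw_inv_into_right[OF tau_bij]

abbreviation "H \<equiv> tens K A B"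
abbreviation "nablaH \<equiv> twist_nabla K A B nablaA nablaB tau"
abbreviation "etaH \<equiv> twist_eta K A B etaA etaB"
abbreviation "deltaH \<equiv> twist_delta K A B deltaA deltaB tau"
abbreviation "epsH \<equiv> twist_eps K A B epsA epsB"

lemma nablaH_linear: "linear_map K (tens K H H) H nablaH"
  unfolding twist_nabla_def by (rule linear_map_compose[of K _ "tens K (tens K A A) (tens K B B)"]) simp_all

lemma deltaH_linear: "linear_map K H (tens K H H) deltaH"
  unfolding twist_delta_def by (rule linear_map_compose[of K _ "tens K (tens K A A) (tens K B B)"]) simp_all

lemma etaH_eq: "c \<in> carrier K \<Longrightarrow> etaH c = ptens K A B (etaA c) (etaB \<one>\<^bsub>K\<^esub>)"
  by (simp add: twist_eta_def ground_split_def)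

lemma epsH_linear: "linear_map K H (ground K) epsH"
  unfolding twist_eps_def by (rule linear_map_compose[of K _ "tens K (ground K) (ground K)"]) simp_all

lemma epsH_ptens:
  "a \<in> carrier A \<Longrightarrow> b \<in> carrier B \<Longrightarrow> epsH (ptens K A B a b) = epsA a \<otimes>\<^bsub>K\<^esub> epsB b"
  by (simp add: twist_eps_def)


lemma tau_inv_unit [simp]:
  "a \<in> carrier A \<Longrightarrow> tau_inv (ptens K A B a (etaB \<one>\<^bsub>K\<^esub>)) = ptens K B A (etaB \<one>\<^bsub>K\<^esub>) a"
  "b \<in> carrier B \<Longrightarrow> tau_inv (ptens K A B (etaA \<one>\<^bsub>K\<^esub>) b) = ptens K B A b (etaA \<one>\<^bsub>K\<^esub>)"
  using bij_betw_inv_into_left[OF tau_bij, of "ptens K B A (etaB \<one>\<^bsub>K\<^esub>) a"]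
    bij_betw_inv_into_left[OF tau_bij, of "ptens K B A b (etaA \<one>\<^bsub>K\<^esub>)"]
  by (simp_all del: bij_betw_inv_into_left[OF tau_bij])

lemma nablaH_insert:
  assumes "a \<in> carrier A" "b \<in> carrier B" "a' \<in> carrier A" "b' \<in> carrier B"
  shows "nablaH (ptens K H H (ptens K A B a b) (ptens K A B a' b'))
    = tmap K (tens K A A) (tens K B B) A B nablaA nablaB (tens_insert K A A B B a b' (tau (ptens K B A b a')))"
  using assms by (simp add: twist_nabla_def)

lemma nablaH_units:
  assumes "a \<in> carrier A" "b \<in> carrier B"
  shows "nablaH (ptens K H H (ptens K A B (etaA \<one>\<^bsub>K\<^esub>) b) (ptens K A B a (etaB \<one>\<^bsub>K\<^esub>)))
    = tau (ptens K B A b a)"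
proof -
  \<comment> \<open>The outer factors are units, so multiplying them in changes nothing and only the
    middle \<open>tau\<close> survives.\<close>
  have "tmap K (tens K A A) (tens K B B) A B nablaA nablaB
      (tens_insert K A A B B (etaA \<one>\<^bsub>K\<^esub>) (etaB \<one>\<^bsub>K\<^esub>) y) = y" if "y \<in> carrier H" for y
    using that by (rule tens_induct[rotated 2]) simp_all
  then show ?thesis using assms by (simp add: nablaH_insert)
qed

text \<open>The unit of \<open>A\<close> is grouplike and \<open>tau_inv\<close> moves it past every
  element of \<open>B\<close>, so the coproduct comes from \<open>deltaB\<close> alone.\<close>

lemma deltaH_unit_A:
  assumes "b \<in> carrier B"
  shows "deltaH (ptens K A B (etaA \<one>\<^bsub>K\<^esub>) b)
    = tmap K B B H H (ptens K A B (etaA \<one>\<^bsub>K\<^esub>)) (ptens K A B (etaA \<one>\<^bsub>K\<^esub>)) (deltaB b)"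
proof -
  have lin: "linear_map K B H (ptens K A B (etaA \<one>\<^bsub>K\<^esub>))"
    by (rule linear_mapI) simp_all
  \<comment> \<open>\<open>deltaB b\<close> is generalised to an arbitrary tensor \<open>q\<close>
    to allow induction on pure tensors.\<close>
  have "mid_map K A A B B B A tau_inv
      (ptens K (tens K A A) (tens K B B) (ptens K A A (etaA \<one>\<^bsub>K\<^esub>) (etaA \<one>\<^bsub>K\<^esub>)) q)
    = tmap K B B H H (ptens K A B (etaA \<one>\<^bsub>K\<^esub>)) (ptens K A B (etaA \<one>\<^bsub>K\<^esub>)) q"
    if "q \<in> carrier (tens K B B)" for q
    using that by (rule tens_induct[rotated 2]) (simp_all add: lin)
  then show ?thesis using assms by (simp add: twist_delta_def)
qed

lemma deltaH_unit_B:
  assumes "a \<in> carrier A"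
  shows "deltaH (ptens K A B a (etaB \<one>\<^bsub>K\<^esub>))
    = tmap K A A H H (\<lambda>a. ptens K A B a (etaB \<one>\<^bsub>K\<^esub>)) (\<lambda>a. ptens K A B a (etaB \<one>\<^bsub>K\<^esub>)) (deltaA a)"
proof -
  have lin: "linear_map K A H (\<lambda>a. ptens K A B a (etaB \<one>\<^bsub>K\<^esub>))"
    by (rule linear_mapI) simp_all
  have "mid_map K A A B B B A tau_inv
      (ptens K (tens K A A) (tens K B B) p (ptens K B B (etaB \<one>\<^bsub>K\<^esub>) (etaB \<one>\<^bsub>K\<^esub>)))
    = tmap K A A H H (\<lambda>a. ptens K A B a (etaB \<one>\<^bsub>K\<^esub>)) (\<lambda>a. ptens K A B a (etaB \<one>\<^bsub>K\<^esub>)) p"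
    if "p \<in> carrier (tens K A A)" for p
    using that by (rule tens_induct[rotated 2]) (simp_all add: lin)
  then show ?thesis using assms by (simp add: twist_delta_def)
qed

text \<open>\<open>deltaH\<close> ends with \<open>tau_inv\<close> in the middle, which
  \<open>tau\<close> undoes. This removes the inverse from the compatibility condition.\<close>

lemma mid_tau_deltaH:
  assumes "y \<in> carrier H"
  shows "mid_map K A B A B A B tau (deltaH y) = tmap K A B (tens K A A) (tens K B B) deltaA deltaB y"
proof -
  have "mid_map K A B A B A B tau (mid_map K A A B B B A tau_inv z) = z"
    if "z \<in> carrier (tens K (tens K A A) (tens K B B))" for z
    using that
    by (rule tens_tens_induct[rotated 4]) (simp_all add: mid_map_tens_insert)
  then show ?thesis using assms by (simp add: twist_delta_def)
qed

section \<open>Counit contractions: \<open>left\<close> and \<open>right\<close> name the factor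
  removed, \<open>to_A\<close> and \<open>to_B\<close> the factor kept\<close>

definition "left_A x = lunit K A (tmap K A A (ground K) A epsA id x)"
definition "left_B x = lunit K B (tmap K B B (ground K) B epsB id x)"
definition "right_A x = runit K A (tmap K A A A (ground K) id epsA x)"
definition "right_B x = runit K B (tmap K B B B (ground K) id epsB x)"
definition "to_A x = runit K A (tmap K A B A (ground K) id epsB x)"
definition "to_B x = lunit K B (tmap K A B (ground K) B epsA id x)"

lemmas collapse_defs = left_A_def left_B_def right_A_def right_B_def to_A_def to_B_def

lemma collapse_linear:
  "linear_map K (tens K A A) A left_A" "linear_map K (tens K A A) A right_A"
  "linear_map K (tens K B B) B left_B" "linear_map K (tens K B B) B right_B"
  "linear_map K H A to_A" "linear_map K H B to_B"
  unfolding collapse_defs by (rule linear_mapI; simp)+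

lemmas collapse_linear_simps [simp] =
  collapse_linear collapse_linear[THEN linear_map_closed] collapse_linear[THEN linear_map_add]
  collapse_linear[THEN linear_map_smult]

lemma collapse_ptens [simp]:
  "a \<in> carrier A \<Longrightarrow> a' \<in> carrier A \<Longrightarrow> left_A (ptens K A A a a') = epsA a \<odot>\<^bsub>A\<^esub> a'"
  "a \<in> carrier A \<Longrightarrow> a' \<in> carrier A \<Longrightarrow> right_A (ptens K A A a a') = epsA a' \<odot>\<^bsub>A\<^esub> a"
  "b \<in> carrier B \<Longrightarrow> b' \<in> carrier B \<Longrightarrow> left_B (ptens K B B b b') = epsB b \<odot>\<^bsub>B\<^esub> b'"
  "b \<in> carrier B \<Longrightarrow> b' \<in> carrier B \<Longrightarrow> right_B (ptens K B B b b') = epsB b' \<odot>\<^bsub>B\<^esub> b"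
  "a \<in> carrier A \<Longrightarrow> b \<in> carrier B \<Longrightarrow> to_A (ptens K A B a b) = epsB b \<odot>\<^bsub>A\<^esub> a"
  "a \<in> carrier A \<Longrightarrow> b \<in> carrier B \<Longrightarrow> to_B (ptens K A B a b) = epsA a \<odot>\<^bsub>B\<^esub> b"
  by (simp_all add: collapse_defs)

lemma collapse_delta [simp]:
  "a \<in> carrier A \<Longrightarrow> left_A (deltaA a) = a" "a \<in> carrier A \<Longrightarrow> right_A (deltaA a) = a"
  "b \<in> carrier B \<Longrightarrow> left_B (deltaB b) = b" "b \<in> carrier B \<Longrightarrow> right_B (deltaB b) = b"
  by (simp_all add: collapse_defs)

lemma H_vs: "vectorspace K H"
  by simp

text \<open>The last equation is permutative: as an ordered rewrite rule it puts nested scalars into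
  a standard order.\<close>

lemma H_smult:
  "c \<in> carrier K \<Longrightarrow> d \<in> carrier K \<Longrightarrow> y \<in> carrier H \<Longrightarrow> (c \<oplus>\<^bsub>K\<^esub> d) \<odot>\<^bsub>H\<^esub> y = c \<odot>\<^bsub>H\<^esub> y \<oplus>\<^bsub>H\<^esub> d \<odot>\<^bsub>H\<^esub> y"
  "c \<in> carrier K \<Longrightarrow> x \<in> carrier H \<Longrightarrow> y \<in> carrier H \<Longrightarrow> c \<odot>\<^bsub>H\<^esub> (x \<oplus>\<^bsub>H\<^esub> y) = c \<odot>\<^bsub>H\<^esub> x \<oplus>\<^bsub>H\<^esub> c \<odot>\<^bsub>H\<^esub> y"
  "c \<in> carrier K \<Longrightarrow> d \<in> carrier K \<Longrightarrow> y \<in> carrier H \<Longrightarrow> (c \<otimes>\<^bsub>K\<^esub> d) \<odot>\<^bsub>H\<^esub> y = c \<odot>\<^bsub>H\<^esub> (d \<odot>\<^bsub>H\<^esub> y)"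
  "c \<in> carrier K \<Longrightarrow> d \<in> carrier K \<Longrightarrow> y \<in> carrier H \<Longrightarrow> c \<odot>\<^bsub>H\<^esub> (d \<odot>\<^bsub>H\<^esub> y) = d \<odot>\<^bsub>H\<^esub> (c \<odot>\<^bsub>H\<^esub> y)"
proof -
  interpret H: vectorspace K H by (rule H_vs)
  show "c \<in> carrier K \<Longrightarrow> d \<in> carrier K \<Longrightarrow> y \<in> carrier H \<Longrightarrow> (c \<oplus>\<^bsub>K\<^esub> d) \<odot>\<^bsub>H\<^esub> y = c \<odot>\<^bsub>H\<^esub> y \<oplus>\<^bsub>H\<^esub> d \<odot>\<^bsub>H\<^esub> y"
    by (rule H.smult_l_distr)
  show "c \<in> carrier K \<Longrightarrow> x \<in> carrier H \<Longrightarrow> y \<in> carrier H \<Longrightarrow> c \<odot>\<^bsub>H\<^esub> (x \<oplus>\<^bsub>H\<^esub> y) = c \<odot>\<^bsub>H\<^esub> x \<oplus>\<^bsub>H\<^esub> c \<odot>\<^bsub>H\<^esub> y"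
    by (rule H.smult_r_distr)
  show "c \<in> carrier K \<Longrightarrow> d \<in> carrier K \<Longrightarrow> y \<in> carrier H \<Longrightarrow> (c \<otimes>\<^bsub>K\<^esub> d) \<odot>\<^bsub>H\<^esub> y = c \<odot>\<^bsub>H\<^esub> (d \<odot>\<^bsub>H\<^esub> y)"
    by (rule H.smult_assoc1)
  show "c \<in> carrier K \<Longrightarrow> d \<in> carrier K \<Longrightarrow> y \<in> carrier H \<Longrightarrow> c \<odot>\<^bsub>H\<^esub> (d \<odot>\<^bsub>H\<^esub> y) = d \<odot>\<^bsub>H\<^esub> (c \<odot>\<^bsub>H\<^esub> y)"
    by (simp add: H.smult_assoc1[symmetric] A.R.m_comm)
qed

lemma epsH_closed [simp]: "y \<in> carrier H \<Longrightarrow> epsH y \<in> carrier K"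
  and epsH_add [simp]: "x \<in> carrier H \<Longrightarrow> y \<in> carrier H \<Longrightarrow> epsH (x \<oplus>\<^bsub>H\<^esub> y) = epsH x \<oplus>\<^bsub>K\<^esub> epsH y"
  using linear_map_closed[OF epsH_linear] linear_map_add[OF epsH_linear] by simp_all

text \<open>On \<open>(A \<otimes> A) \<otimes> (B \<otimes> B)\<close> these are \<epsilon>
  \<otimes> 1 \<otimes> 1 \<otimes> \<epsilon> and 1 \<otimes> \<epsilon> \<otimes> \<epsilon>
  \<otimes> 1. By the counit axioms both are left inverse to
  \<open>deltaA \<otimes> deltaB\<close>.\<close>

abbreviation "outer \<equiv> tmap K (tens K A A) (tens K B B) A B left_A right_B"
abbreviation "inner \<equiv> tmap K (tens K A A) (tens K B B) A B right_A left_B"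

lemma outer_delta:
  assumes "y \<in> carrier H"
  shows "outer (tmap K A B (tens K A A) (tens K B B) deltaA deltaB y) = y"
  using assms by (rule tens_induct[rotated 2]) simp_all

lemma inner_delta:
  assumes "y \<in> carrier H"
  shows "inner (tmap K A B (tens K A A) (tens K B B) deltaA deltaB y) = y"
  using assms by (rule tens_induct[rotated 2]) simp_all

text \<open>The inserted \<open>x\<close> and \<open>w\<close> occupy the ends, so the outer counits
  turn them into a scalar and leave \<open>y\<close> intact. In \<open>inner_insert\<close> the
  counits fall on \<open>y\<close> instead.\<close>

lemma outer_insert:
  assumes [simp]: "x \<in> carrier A" "w \<in> carrier B" and y: "y \<in> carrier H"
  shows "outer (tens_insert K A A B B x w y) = (epsA x \<otimes>\<^bsub>K\<^esub> epsB w) \<odot>\<^bsub>H\<^esub> y"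
  using y by (rule tens_induct[rotated 2]) (simp_all add: H_smult)

lemma inner_insert:
  assumes [simp]: "x \<in> carrier A" "w \<in> carrier B" and y: "y \<in> carrier H"
  shows "inner (tens_insert K A A B B x w y) = epsH y \<odot>\<^bsub>H\<^esub> ptens K A B x w"
  using y by (rule tens_induct[rotated 2]) (simp_all add: H_smult epsH_ptens)

lemma eps_to_A:
  assumes "y \<in> carrier H"
  shows "epsA (to_A y) = epsH y"
  using assms by (rule tens_induct[rotated 2]) (simp_all add: epsH_ptens A.R.m_comm)

lemma eps_to_B:
  assumes "y \<in> carrier H"
  shows "epsB (to_B y) = epsH y"
  using assms by (rule tens_induct[rotated 2]) (simp_all add: epsH_ptens)

text \<open>For \<open>t = x \<otimes> b\<close> and \<open>s = a \<otimes> w\<close> the middle map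
  puts \<open>tau (b \<otimes> a)\<close> between \<open>x\<close> and \<open>w\<close>, and only
  these ends are contracted.\<close>

lemma outer_mid:
  assumes "t \<in> carrier H" "s \<in> carrier H"
  shows "outer (mid_map K A B A B A B tau (ptens K H H t s)) = tau (ptens K B A (to_B t) (to_A s))"
  using assms by (rule tens_induct_pair[rotated 4]) (simp_all add: outer_insert H_smult)

text \<open>Here the counits hit the output of the middle \<open>tau\<close>, so the value of
  \<open>epsH\<close> on that output is assumed; the ends survive.\<close>

lemma inner_mid:
  assumes eps_tau: "\<And>b a. b \<in> carrier B \<Longrightarrow> a \<in> carrier A \<Longrightarrow>
      epsH (tau (ptens K B A b a)) = epsB b \<otimes>\<^bsub>K\<^esub> epsA a"
    and "t \<in> carrier H" "s \<in> carrier H"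
  shows "inner (mid_map K A B A B A B tau (ptens K H H t s)) = ptens K A B (to_A t) (to_B s)"
  using assms(2,3) by (rule tens_induct_pair[rotated 4]) (simp_all add: inner_insert eps_tau H_smult)

section \<open>A bialgebra structure forces the twist to be the flip\<close>

lemma trivial_if_bialgebra:
  assumes "k_bialgebra K H nablaH etaH deltaH epsH"
  shows "trivial_twist K A B tau"
proof -
  interpret H: k_bialgebra K H nablaH etaH deltaH epsH by fact
  \<comment> \<open>Multiplicativity of \<open>epsH\<close> on the product
    \<open>(1 \<otimes> b)(a \<otimes> 1)\<close>; the counits of the units are one.\<close>
  have eps_tau: "epsH (tau (ptens K B A b a)) = epsB b \<otimes>\<^bsub>K\<^esub> epsA a"
    if [simp]: "b \<in> carrier B" "a \<in> carrier A" for b a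
    using H.eps_nabla_ptens[of "ptens K A B (etaA \<one>\<^bsub>K\<^esub>) b" "ptens K A B a (etaB \<one>\<^bsub>K\<^esub>)"]
    by (simp add: nablaH_units epsH_ptens)
  \<comment> \<open>In Sweedler notation \<open>(b\<^sub>1 \<otimes> a\<^sub>1) \<otimes> (b\<^sub>2
    \<otimes> a\<^sub>2)\<close>.\<close>
  let ?R = "\<lambda>b a. mid_map K B B A A A B (tflip K B A) (ptens K (tens K B B) (tens K A A) (deltaB b) (deltaA a))"
  have delta_tau: "deltaH (tau (ptens K B A b a))
      = tmap K (tens K B A) (tens K B A) H H tau tau (?R b a)"
    if [simp]: "b \<in> carrier B" "a \<in> carrier A" for b a
  proof -
    have lin: "linear_map K B H (ptens K A B (etaA \<one>\<^bsub>K\<^esub>))"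
      "linear_map K A H (\<lambda>a. ptens K A B a (etaB \<one>\<^bsub>K\<^esub>))"
      by (rule linear_mapI; simp)+
    \<comment> \<open>After the flip in the middle, each factor is a product of the form
      \<open>(1 \<otimes> b)(a \<otimes> 1)\<close>, which \<open>nablaH_units\<close> turns into a
      value of \<open>tau\<close>.\<close>
    have "tmap K (tens K H H) (tens K H H) H H nablaH nablaH
        (mid_map K H H H H H H (tflip K H H) (ptens K (tens K H H) (tens K H H)
          (tmap K B B H H (ptens K A B (etaA \<one>\<^bsub>K\<^esub>)) (ptens K A B (etaA \<one>\<^bsub>K\<^esub>)) q)
          (tmap K A A H H (\<lambda>a. ptens K A B a (etaB \<one>\<^bsub>K\<^esub>)) (\<lambda>a. ptens K A B a (etaB \<one>\<^bsub>K\<^esub>)) p)))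
      = tmap K (tens K B A) (tens K B A) H H tau tau
          (mid_map K B B A A A B (tflip K B A) (ptens K (tens K B B) (tens K A A) q p))"
      if "q \<in> carrier (tens K B B)" "p \<in> carrier (tens K A A)" for q p
      using that
      by (rule tens_induct_pair[rotated 4]) (simp_all add: lin nablaH_linear nablaH_units)
    then show ?thesis
      using H.delta_nabla_ptens[of "ptens K A B (etaA \<one>\<^bsub>K\<^esub>) b" "ptens K A B a (etaB \<one>\<^bsub>K\<^esub>)"]
      by (simp add: nablaH_units deltaH_unit_A deltaH_unit_B)
  qed

  have main: "tmap K A B (tens K A A) (tens K B B) deltaA deltaB (tau (ptens K B A b a))
      = mid_map K A B A B A B tau (tmap K (tens K B A) (tens K B A) H H tau tau (?R b a))"
    if "b \<in> carrier B" "a \<in> carrier A" for b a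
    using mid_tau_deltaH[of "tau (ptens K B A b a)"] delta_tau[OF that] that by simp
  have lin: "linear_map K (tens K B A) A (\<lambda>x. to_A (tau x))" "linear_map K (tens K B A) B (\<lambda>x. to_B (tau x))"
    by (rule linear_mapI; simp)+
  have R_closed: "?R b a \<in> carrier (tens K (tens K B A) (tens K B A))"
    if "b \<in> carrier B" "a \<in> carrier A" for b a
    using that by simp
  \<comment> \<open>The two contractions of the right side of \<open>main\<close>, for an arbitrary
    \<open>y\<close> in place of the shuffled coproducts.\<close>
  have outer_R: "outer (mid_map K A B A B A B tau (tmap K (tens K B A) (tens K B A) H H tau tau y))
      = tau (tmap K (tens K B A) (tens K B A) B A (\<lambda>x. to_B (tau x)) (\<lambda>x. to_A (tau x)) y)"
    if "y \<in> carrier (tens K (tens K B A) (tens K B A))" for y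
    using that by (rule tens_induct[rotated 2]) (simp_all add: lin outer_mid)
  have inner_R: "inner (mid_map K A B A B A B tau (tmap K (tens K B A) (tens K B A) H H tau tau y))
      = tmap K (tens K B A) (tens K B A) A B (\<lambda>x. to_A (tau x)) (\<lambda>x. to_B (tau x)) y"
    if "y \<in> carrier (tens K (tens K B A) (tens K B A))" for y
    using that by (rule tens_induct[rotated 2]) (simp_all add: lin inner_mid[OF eps_tau])
  \<comment> \<open>The outer contraction of \<open>main\<close> has \<open>tau\<close> at the front
    of both sides; injectivity cancels it.\<close>
  have split: "ptens K B A b a
      = tmap K (tens K B A) (tens K B A) B A (\<lambda>x. to_B (tau x)) (\<lambda>x. to_A (tau x)) (?R b a)"
    if "b \<in> carrier B" "a \<in> carrier A" for b a
  proof (rule inj_onD[OF bij_betw_imp_inj_on[OF tau_bij]])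
    show "tau (ptens K B A b a)
        = tau (tmap K (tens K B A) (tens K B A) B A (\<lambda>x. to_B (tau x)) (\<lambda>x. to_A (tau x)) (?R b a))"
      using arg_cong[OF main[OF that], of outer] outer_R[OF R_closed[OF that]]
        outer_delta[of "tau (ptens K B A b a)"] that by simp
  qed (use that in \<open>simp_all add: lin\<close>)
  have to_A_tau: "to_A (tau (ptens K B A b a)) = epsB b \<odot>\<^bsub>A\<^esub> a"
    and to_B_tau: "to_B (tau (ptens K B A b a)) = epsA a \<odot>\<^bsub>B\<^esub> b"
    if "b \<in> carrier B" "a \<in> carrier A" for b a
  proof -
    \<comment> \<open>The contractions \<epsilon> \<otimes> 1 and 1 \<otimes> \<epsilon> on
      \<open>B \<otimes> A\<close>, to be applied to both sides of \<open>split\<close>.\<close>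
    define LA where "LA x = lunit K A (tmap K B A (ground K) A epsB id x)" for x
    define RB where "RB x = runit K B (tmap K B A B (ground K) id epsA x)" for x
    have LR: "linear_map K (tens K B A) A LA" "linear_map K (tens K B A) B RB"
      unfolding LA_def RB_def by (rule linear_mapI; simp)+
    note [simp] = LR LR[THEN linear_map_add]
    have [simp]: "LA (ptens K B A b a) = epsB b \<odot>\<^bsub>A\<^esub> a" "RB (ptens K B A b a) = epsA a \<odot>\<^bsub>B\<^esub> b"
      if "b \<in> carrier B" "a \<in> carrier A" for b a
      using that by (simp_all add: LA_def RB_def)
    let ?S = "\<lambda>q p. tmap K (tens K B A) (tens K B A) B A (\<lambda>x. to_B (tau x)) (\<lambda>x. to_A (tau x))
        (mid_map K B B A A A B (tflip K B A) (ptens K (tens K B B) (tens K A A) q p))"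
    \<comment> \<open>The contracted factor becomes the scalar
      \<open>epsB b\<^sub>1 * epsA a\<^sub>1\<close> by \<open>eps_to_B\<close> and
      \<open>eps_tau\<close>; it is absorbed into the other factor, where the counit axioms
      finish.\<close>
    have LS: "LA (?S q p) = to_A (tau (ptens K B A (left_B q) (left_A p)))"
      if "q \<in> carrier (tens K B B)" "p \<in> carrier (tens K A A)" for q p
      using that by (rule tens_induct_pair[rotated 4])
        (simp_all add: lin eps_to_B eps_tau A.smult_assoc1[symmetric] A.R.m_comm)
    have RS: "RB (?S q p) = to_B (tau (ptens K B A (right_B q) (right_A p)))"
      if "q \<in> carrier (tens K B B)" "p \<in> carrier (tens K A A)" for q p
      using that by (rule tens_induct_pair[rotated 4])
        (simp_all add: lin eps_to_A eps_tau B.smult_assoc1[symmetric] A.R.m_comm)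
    show "to_A (tau (ptens K B A b a)) = epsB b \<odot>\<^bsub>A\<^esub> a"
      using LS[of "deltaB b" "deltaA a"] split[OF that, symmetric] that by simp
    show "to_B (tau (ptens K B A b a)) = epsA a \<odot>\<^bsub>B\<^esub> b"
      using RS[of "deltaB b" "deltaA a"] split[OF that, symmetric] that by simp
  qed
  \<comment> \<open>With \<open>to_A_tau\<close> and \<open>to_B_tau\<close> known, each factor
    carries a counit value belonging to the other; the scalars are regrouped.\<close>
  have inner_flip: "tmap K (tens K B A) (tens K B A) A B (\<lambda>x. to_A (tau x)) (\<lambda>x. to_B (tau x))
      (mid_map K B B A A A B (tflip K B A) (ptens K (tens K B B) (tens K A A) q p))
    = ptens K A B (right_A p) (left_B q)"
    if "q \<in> carrier (tens K B B)" "p \<in> carrier (tens K A A)" for q p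
    using that by (rule tens_induct_pair[rotated 4]) (simp_all add: lin to_A_tau to_B_tau H_smult)
  have tau_ptens: "tau (ptens K B A b a) = ptens K A B a b" if "b \<in> carrier B" "a \<in> carrier A" for b a
  proof -
    have "tau (ptens K B A b a)
        = tmap K (tens K B A) (tens K B A) A B (\<lambda>x. to_A (tau x)) (\<lambda>x. to_B (tau x)) (?R b a)"
      using arg_cong[OF main[OF that], of inner] inner_R[OF R_closed[OF that]]
        inner_delta[of "tau (ptens K B A b a)"] that by simp
    also have "\<dots> = ptens K A B a b"
      using inner_flip[of "deltaB b" "deltaA a"] that by simp
    finally show ?thesis .
  qed
  show ?thesis
    unfolding trivial_twist_def
  proof
    fix x assume "x \<in> carrier (tens K B A)"
    then show "tau x = tflip K B A x"
      by (rule tens_induct[rotated 2]) (simp_all add: tau_ptens)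
  qed
qed

end

section \<open>Converse: the ordinary tensor product of bialgebras\<close>

locale untwisted_bialgebras = twisted_bialgebras +
  assumes trivial: "trivial_twist K A B tau"
begin

lemma tau_ptens [simp]:
  assumes "b \<in> carrier B" "a \<in> carrier A"
  shows "tau (ptens K B A b a) = ptens K A B a b"
  using trivial assms by (simp add: trivial_twist_def)

lemma tau_inv_ptens [simp]:
  assumes "b \<in> carrier B" "a \<in> carrier A"
  shows "tau_inv (ptens K A B a b) = ptens K B A b a"
  using bij_betw_inv_into_left[OF tau_bij, of "ptens K B A b a"] assms
  by (simp del: bij_betw_inv_into_left[OF tau_bij])

text \<open>Resolution with the induction rules eta-expands arguments \<^term>\<open>id\<close>, and simplification then turns
  them into \<open>\<lambda>x. x\<close>; the equation \<open>id_def[symmetric]\<close> restores them.\<close>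

lemmas [simp] = id_def[symmetric] nablaH_linear linear_map_closed[OF nablaH_linear] linear_map_add[OF nablaH_linear]
  deltaH_linear linear_map_closed[OF deltaH_linear] linear_map_add[OF deltaH_linear]
  epsH_linear epsH_ptens

text \<open>Since \<open>tau_inv\<close> is now the flip, \<open>a \<otimes> a'\<close> and
  \<open>b \<otimes> b'\<close> give
  \<open>(a \<otimes> b) \<otimes> (a' \<otimes> b')\<close>.\<close>

abbreviation "shuffle p q \<equiv> mid_map K A A B B B A tau_inv (ptens K (tens K A A) (tens K B B) p q)"

lemma nablaH_ptens [simp]:
  assumes "a \<in> carrier A" "b \<in> carrier B" "a' \<in> carrier A" "b' \<in> carrier B"
  shows "nablaH (ptens K H H (ptens K A B a b) (ptens K A B a' b'))
    = ptens K A B (nablaA (ptens K A A a a')) (nablaB (ptens K B B b b'))"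
  using assms by (simp add: twist_nabla_def)

lemma deltaH_ptens [simp]:
  assumes "a \<in> carrier A" "b \<in> carrier B"
  shows "deltaH (ptens K A B a b) = shuffle (deltaA a) (deltaB b)"
  using assms by (simp add: twist_delta_def)

lemma etaH_linear [simp]: "linear_map K (ground K) H etaH"
  by (rule linear_mapI) (simp_all add: etaH_eq linear_map_smult[OF A.eta_linear, simplified])

lemma nablaH_assoc:
  assumes "x \<in> carrier (tens K (tens K H H) H)"
  shows "nablaH (tmap K (tens K H H) H H H nablaH id x)
    = nablaH (tmap K H (tens K H H) H H id nablaH (assoc_r K H H H x))"
proof -
  have *: "nablaH (ptens K H H (nablaH p) h)
      = nablaH (tmap K H (tens K H H) H H id nablaH (assoc_r K H H H (ptens K (tens K H H) H p h)))"
    if h: "h \<in> carrier H" and p: "p \<in> carrier (tens K H H)" for p h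
    using p
  proof (rule tens_tens_induct[rotated 4])
    fix a b a' b'
    assume [simp]: "a \<in> carrier A" "b \<in> carrier B" "a' \<in> carrier A" "b' \<in> carrier B"
    show "nablaH (ptens K H H (nablaH (ptens K H H (ptens K A B a b) (ptens K A B a' b'))) h)
      = nablaH (tmap K H (tens K H H) H H id nablaH (assoc_r K H H H
          (ptens K (tens K H H) H (ptens K H H (ptens K A B a b) (ptens K A B a' b')) h)))"
      using h by (rule tens_induct[rotated 2]) simp_all
  qed (simp_all add: h)
  from assms show ?thesis
    by (rule tens_induct[rotated 2]) (simp_all add: *)
qed

lemma etaH_left:
  assumes "y \<in> carrier (tens K (ground K) H)"
  shows "nablaH (tmap K (ground K) H H H etaH id y) = lunit K H y"
proof -
  have *: "nablaH (ptens K H H (etaH c) h) = c \<odot>\<^bsub>H\<^esub> h"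
    if "c \<in> carrier K" and h: "h \<in> carrier H" for c h
    using h by (rule tens_induct[rotated 2]) (simp_all add: that etaH_eq H_smult)
  from assms show ?thesis
    by (rule tens_induct[rotated 2]) (simp_all add: *)
qed

lemma etaH_right:
  assumes "y \<in> carrier (tens K H (ground K))"
  shows "nablaH (tmap K H (ground K) H H id etaH y) = runit K H y"
proof -
  have *: "nablaH (ptens K H H h (etaH c)) = c \<odot>\<^bsub>H\<^esub> h"
    if "c \<in> carrier K" and h: "h \<in> carrier H" for c h
    using h by (rule tens_induct[rotated 2]) (simp_all add: that etaH_eq H_smult)
  from assms show ?thesis
    by (rule tens_induct[rotated 2]) (simp_all add: *)
qed

lemma deltaH_coassoc:
  assumes "h \<in> carrier H"
  shows "assoc_r K H H H (tmap K H H (tens K H H) H deltaH id (deltaH h))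
    = tmap K H H H (tens K H H) id deltaH (deltaH h)"
proof -
  \<comment> \<open>\<open>shuffle3\<close> pairs
    \<open>a\<^sub>1 \<otimes> (a\<^sub>2 \<otimes> a\<^sub>3)\<close> with
    \<open>b\<^sub>1 \<otimes> (b\<^sub>2 \<otimes> b\<^sub>3)\<close> entry by entry;
    \<open>mid\<close> first moves the block \<open>A \<otimes> A\<close> past one \<open>B\<close>.
    Both sides of coassociativity are \<open>shuffle3\<close> of iterated coproducts, which agree in
    \<open>A\<close> and in \<open>B\<close>.\<close>
  define mid where "mid = mid_map K A (tens K A A) B (tens K B B) B (tens K A A) (tflip K (tens K A A) B)"
  define shuffle3 where "shuffle3 x y =
      tmap K H (tens K (tens K A A) (tens K B B)) H (tens K H H) id (mid_map K A A B B B A tau_inv)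
        (mid (ptens K (tens K A (tens K A A)) (tens K B (tens K B B)) x y))" for x y
  \<comment> \<open>Expanding \<open>deltaH\<close> on a pure tensor leaves the shuffle of
    \<open>deltaA a\<close> and \<open>deltaB b\<close>, which requires an induction of its
    own.\<close>
  have left_pure: "assoc_r K H H H (ptens K (tens K H H) H (shuffle p q) (ptens K A B a b))
      = shuffle3 (assoc_r K A A A (ptens K (tens K A A) A p a)) (assoc_r K B B B (ptens K (tens K B B) B q b))"
    if "a \<in> carrier A" "b \<in> carrier B" "p \<in> carrier (tens K A A)" "q \<in> carrier (tens K B B)" for a b p q
    using that(3,4)
    by (rule tens_induct_pair[rotated 4]) (simp_all add: that(1,2) shuffle3_def mid_def)
  have left: "assoc_r K H H H (tmap K H H (tens K H H) H deltaH id (shuffle p q))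
      = shuffle3 (assoc_r K A A A (tmap K A A (tens K A A) A deltaA id p))
          (assoc_r K B B B (tmap K B B (tens K B B) B deltaB id q))"
    if "p \<in> carrier (tens K A A)" "q \<in> carrier (tens K B B)" for p q
    using that
  proof (rule tens_induct_pair[rotated 4])
    fix a a' b b'
    assume [simp]: "a \<in> carrier A" "a' \<in> carrier A" "b \<in> carrier B" "b' \<in> carrier B"
    show "assoc_r K H H H (tmap K H H (tens K H H) H deltaH id (shuffle (ptens K A A a a') (ptens K B B b b')))
      = shuffle3 (assoc_r K A A A (tmap K A A (tens K A A) A deltaA id (ptens K A A a a')))
          (assoc_r K B B B (tmap K B B (tens K B B) B deltaB id (ptens K B B b b')))"
      using left_pure[of a' b' "deltaA a" "deltaB b"] by simp
  qed (simp_all add: shuffle3_def mid_def)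
  have right: "tmap K H H H (tens K H H) id deltaH (shuffle p q)
      = shuffle3 (tmap K A A A (tens K A A) id deltaA p) (tmap K B B B (tens K B B) id deltaB q)"
    if "p \<in> carrier (tens K A A)" "q \<in> carrier (tens K B B)" for p q
    using that
    by (rule tens_induct_pair[rotated 4]) (simp_all add: shuffle3_def mid_def)
  from assms show ?thesis
    by (rule tens_induct[rotated 2])
      (simp_all add: left right A.delta_coassoc B.delta_coassoc)
qed

text \<open>Contracting a shuffle contracts its two arguments separately, so the counit axioms of
  \<open>A\<close> and \<open>B\<close> apply.\<close>

lemma epsH_left:
  assumes "h \<in> carrier H"
  shows "lunit K H (tmap K H H (ground K) H epsH id (deltaH h)) = h"
proof -
  have *: "lunit K H (tmap K H H (ground K) H epsH id (shuffle p q)) = ptens K A B (left_A p) (left_B q)"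
    if "p \<in> carrier (tens K A A)" "q \<in> carrier (tens K B B)" for p q
    using that by (rule tens_induct_pair[rotated 4]) (simp_all add: H_smult)
  from assms show ?thesis
    by (rule tens_induct[rotated 2]) (simp_all add: *)
qed

lemma epsH_right:
  assumes "h \<in> carrier H"
  shows "runit K H (tmap K H H H (ground K) id epsH (deltaH h)) = h"
proof -
  have *: "runit K H (tmap K H H H (ground K) id epsH (shuffle p q)) = ptens K A B (right_A p) (right_B q)"
    if "p \<in> carrier (tens K A A)" "q \<in> carrier (tens K B B)" for p q
    using that by (rule tens_induct_pair[rotated 4]) (simp_all add: H_smult)
  from assms show ?thesis
    by (rule tens_induct[rotated 2]) (simp_all add: *)
qed

lemma deltaH_nablaH:
  assumes "x \<in> carrier (tens K H H)"
  shows "deltaH (nablaH x) = tmap K (tens K H H) (tens K H H) H H nablaH nablaH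
      (mid_map K H H H H H H (tflip K H H) (tmap K H H (tens K H H) (tens K H H) deltaH deltaH x))"
proof -
  let ?midA = "\<lambda>p p'. mid_map K A A A A A A (tflip K A A) (ptens K (tens K A A) (tens K A A) p p')"
  let ?midB = "\<lambda>q q'. mid_map K B B B B B B (tflip K B B) (ptens K (tens K B B) (tens K B B) q q')"
  let ?midH = "\<lambda>r r'. mid_map K H H H H H H (tflip K H H) (ptens K (tens K H H) (tens K H H) r r')"
  \<comment> \<open>Four coproducts occur, so two pair inductions are nested; here the second pair
    is already pure.\<close>
  have pure: "shuffle (tmap K (tens K A A) (tens K A A) A A nablaA nablaA (?midA p (ptens K A A a a')))
        (tmap K (tens K B B) (tens K B B) B B nablaB nablaB (?midB q (ptens K B B b b')))
      = tmap K (tens K H H) (tens K H H) H H nablaH nablaH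
          (?midH (shuffle p q) (shuffle (ptens K A A a a') (ptens K B B b b')))"
    if el: "a \<in> carrier A" "a' \<in> carrier A" "b \<in> carrier B" "b' \<in> carrier B"
      and pq: "p \<in> carrier (tens K A A)" "q \<in> carrier (tens K B B)" for a a' b b' p q
    using pq by (rule tens_induct_pair[rotated 4]) (simp_all add: el)
  have *: "shuffle (tmap K (tens K A A) (tens K A A) A A nablaA nablaA (?midA p p'))
        (tmap K (tens K B B) (tens K B B) B B nablaB nablaB (?midB q q'))
      = tmap K (tens K H H) (tens K H H) H H nablaH nablaH (?midH (shuffle p q) (shuffle p' q'))"
    if pq: "p \<in> carrier (tens K A A)" "q \<in> carrier (tens K B B)"
      and pq': "p' \<in> carrier (tens K A A)" "q' \<in> carrier (tens K B B)" for p q p' q'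
    using pq'
  proof (rule tens_induct_pair[rotated 4])
    show "shuffle (tmap K (tens K A A) (tens K A A) A A nablaA nablaA (?midA p (ptens K A A a a')))
        (tmap K (tens K B B) (tens K B B) B B nablaB nablaB (?midB q (ptens K B B b b')))
      = tmap K (tens K H H) (tens K H H) H H nablaH nablaH
          (?midH (shuffle p q) (shuffle (ptens K A A a a') (ptens K B B b b')))"
      if "a \<in> carrier A" "a' \<in> carrier A" "b \<in> carrier B" "b' \<in> carrier B" for a a' b b'
      by (rule pure[OF that pq])
  qed (simp_all add: pq)
  from assms show ?thesis
    by (rule tens_tens_induct[rotated 4]) (simp_all add: *)
qed

lemma bialgebra: "k_bialgebra K H nablaH etaH deltaH epsH"
proof (intro k_bialgebra.intro k_algebra.intro k_algebra_axioms.intro k_coalgebra.intro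
    k_coalgebra_axioms.intro k_bialgebra_axioms.intro)
  show "deltaH (etaH c) = tmap K (ground K) (ground K) H H etaH etaH (ground_split K c)"
    if "c \<in> carrier K" for c
    using that by (simp add: etaH_eq ground_split_def)
  \<comment> \<open>On pure tensors both sides multiply the same four counit values in different
    orders.\<close>
  show "epsH (nablaH x) = lunit K (ground K) (tmap K H H (ground K) (ground K) epsH epsH x)"
    if "x \<in> carrier (tens K H H)" for x
    using that by (rule tens_tens_induct[rotated 4]) (simp_all add: A.R.m_ac)
  show "epsH (etaH c) = c" if "c \<in> carrier K" for c
    using that by (simp add: etaH_eq)
qed (simp_all add: H_vs nablaH_assoc etaH_left etaH_right deltaH_coassoc epsH_left epsH_right
    deltaH_nablaH)

end

theorem theorem1p1:
  fixes K :: "('k, 'r) ring_scheme"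
    and A :: "('k, 'a, 'm) module_scheme"
    and B :: "('k, 'b, 'n) module_scheme"
  assumes "field K"
    and "k_bialgebra K A nablaA etaA deltaA epsA"
    and "k_bialgebra K B nablaB etaB deltaB epsB"
    and "twisting_map K A nablaA etaA B nablaB etaB tau"
  shows "k_bialgebra K (tens K A B)
           (twist_nabla K A B nablaA nablaB tau) (twist_eta K A B etaA etaB)
           (twist_delta K A B deltaA deltaB tau) (twist_eps K A B epsA epsB)
         \<longleftrightarrow> trivial_twist K A B tau"
proof -
  have twisted: "twisted_bialgebras K A nablaA etaA deltaA epsA B nablaB etaB deltaB epsB tau"
    by (intro twisted_bialgebras.intro assms)
  show ?thesis
    using twisted_bialgebras.trivial_if_bialgebra[OF twisted]
      untwisted_bialgebras.bialgebra[OF untwisted_bialgebras.intro[OF twisted untwisted_bialgebras_axioms.intro]]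
    by blast
qed

end
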